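(* Let $0\le\kappa_0<1$ and let $V(z)\in\mathfrak M_{\kappa_0}$ be realized (as impedance function) by an L-system $\Theta_0$ (with one-dimensional input-output space $\mathbb C$ and $J=1$) containing a symmetric operator $\dot A$ and a state space $\mathcal H_+\subset\mathcal H\subset\mathcal H_-$. Then for any real $Q\neq0$ the function $Q+V(z)$ can be realized as the impedance function of an L-system $\Theta$ with the same symmetric operator $\dot A$ and the same state space $\mathcal H_+\subset\mathcal H\subset\mathcal H_-$ as in $\Theta_0$.
   Context: Class $\mathfrak M_{\kappa_0}$ ($0\le\kappa_0<1$): functions $V(z)=\int_{\mathbb R}\left(\frac{1}{\lambda-z}-\frac{\lambda}{1+\lambda^2}\right)d\mu(\lambda)$ with $\mu$ an infinite Borel measure and $\int_{\mathbb R}\frac{d\mu(\lambda)}{1+\lambda^2}=\frac{1-\kappa_0}{1+\kappa_0}$. Rigged space: for a closed densely defined symmetric operator $\dot A$ with deficiency indices $(1,1)$ in a complex Hilbert space $\mathcal H$, let $\mathcal H_+=\mathrm{Dom}(\dot A^* )$ with $(f,g)_+=(f,g)+(\dot A^*f,\dot A^*g)$, and let $\mathcal H_+\subset\mathcal H\subset\mathcal H_-$ be the associated rigged Hilbert space. $[X,Y]$ denotes bounded linear operators. If $\mathbb A\in[\mathcal H_+,\mathcal H_-]$ then $\mathbb A^*\in[\mathcal H_+,\mathcal H_-]$; $\mathrm{Re}\,\mathbb A=(\mathbb A+\mathbb A^* )/2$, $\mathrm{Im}\,\mathbb A=(\mathbb A-\mathbb A^* )/2i$. The quasi-kernel $\hat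 A$ of $\mathrm{Re}\,\mathbb A$ is its restriction to $\{f\in\mathcal H_+:\mathrm{Re}\,\mathbb A f\in\mathcal H\}$. L-system: let $T$ be a non-symmetric operator with $\dot A\subset T\subset\dot A^*$, $\rho(T)\ne\emptyset$, $\mathrm{Dom}(\dot A)=\mathrm{Dom}(T)\cap\mathrm{Dom}(T^* )$. A $( * )$-extension of $T$ is $\mathbb A\in[\mathcal H_+,\mathcal H_-]$ with $\dot A\subset T\subset\mathbb A$, $\dot A\subset T^*\subset\mathbb A^*$ such that the quasi-kernel $\hat A$ of $\mathrm{Re}\,\mathbb A$ is self-adjoint in $\mathcal H$. An L-system is $\Theta=\begin{pmatrix}\mathbb A&K&1\\ \mathcal H_+\subset\mathcal H\subset\mathcal H_-&&\mathbb C\end{pmatrix}$ where $\mathbb A$ is a $( * )$-extension of such a $T$ (main operator), $K\in[\mathbb C,\mathcal H_-]$, $\mathrm{Im}\,\mathbb A=KK^*$, $\mathrm{Ran}(K)=\mathrm{Ran}(\mathrm{Im}\,\mathbb A)$. Impedance function: $V_\Theta(z)=K^*(\mathrm{Re}\,\mathbb A-zI)^{-1}K$, $z\in\rho(\hat A)$. An L-system is said to realize $V$ if $V=V_\Theta$ on $\mathbb C_\pm$. *)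

theory Defs
  imports "HOL-Analysis.Analysis"
begin

section \<open>Complex Hilbert spaces\<close>

text \<open>The inner product is linear in the first and antilinear in the second argument.\<close>

class chilbert_space = real_inner + banach +
  fixes scaleC :: "complex \<Rightarrow> 'a \<Rightarrow> 'a"  (infixr "*\<^sub>C" 75)
    and cinner :: "'a \<Rightarrow> 'a \<Rightarrow> complex"
  assumes scaleC_add_right: "a *\<^sub>C (x + y) = a *\<^sub>C x + a *\<^sub>C y"
    and scaleC_add_left: "(a + b) *\<^sub>C x = a *\<^sub>C x + b *\<^sub>C x"
    and scaleC_scaleC: "a *\<^sub>C b *\<^sub>C x = (a * b) *\<^sub>C x"
    and scaleC_of_real: "complex_of_real r *\<^sub>C x = r *\<^sub>R x"
    and cinner_add_left: "cinner (x + y) z = cinner x z + cinner y z"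
    and cinner_scaleC_left: "cinner (a *\<^sub>C x) y = a * cinner x y"
    and cinner_commute: "cinner x y = cnj (cinner y x)"
    and Re_cinner: "Re (cinner x y) = inner x y"

interpretation complex_vector: vector_space "scaleC :: complex \<Rightarrow> 'a \<Rightarrow> 'a::chilbert_space"
proof
  fix x :: 'a
  show "1 *\<^sub>C x = x"
    using scaleC_of_real[of 1 x] by simp
qed (simp_all add: scaleC_add_right scaleC_add_left scaleC_scaleC)


section \<open>Unbounded operators\<close>

text \<open>An unbounded operator is represented by its graph; the extension relation between
  operators is then inclusion of sets.\<close>

type_synonym 'h op = "('h \<times> 'h) set"

definition linear_op :: "'h::chilbert_space op \<Rightarrow> bool" where
  "linear_op G \<longleftrightarrow> single_valued G \<and> (0, 0) \<in> G \<and>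
     (\<forall>(x, y)\<in>G. \<forall>(x', y')\<in>G. (x + x', y + y') \<in> G) \<and>
     (\<forall>c. \<forall>(x, y)\<in>G. (c *\<^sub>C x, c *\<^sub>C y) \<in> G)"

definition densely_defined :: "'h::chilbert_space op \<Rightarrow> bool" where
  "densely_defined G \<longleftrightarrow> closure (Domain G) = UNIV"

text \<open>For densely defined \<open>G\<close> this is the graph of the adjoint operator.\<close>

definition adj :: "'h::chilbert_space op \<Rightarrow> 'h op" where
  "adj G = {(u, v). \<forall>(x, y)\<in>G. cinner y u = cinner x v}"

definition op_app :: "'h op \<Rightarrow> 'h \<Rightarrow> 'h" where
  "op_app G x = (THE y. (x, y) \<in> G)"

definition symmetric_op :: "'h::chilbert_space op \<Rightarrow> bool" where
  "symmetric_op G \<longleftrightarrow> linear_op G \<and> densely_defined G \<and> G \<subseteq> adj G"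

definition self_adjoint_op :: "'h::chilbert_space op \<Rightarrow> bool" where
  "self_adjoint_op G \<longleftrightarrow> linear_op G \<and> densely_defined G \<and> adj G = G"

definition resolvent_set :: "'h::chilbert_space op \<Rightarrow> complex set" where
  "resolvent_set G = {z. (\<forall>h. \<exists>!f. \<exists>y. (f, y) \<in> G \<and> y - z *\<^sub>C f = h) \<and>
     (\<exists>C. \<forall>(f, y)\<in>G. norm f \<le> C * norm (y - z *\<^sub>C f))}"

definition deficiency_subspace :: "'h::chilbert_space op \<Rightarrow> complex \<Rightarrow> 'h set" where
  "deficiency_subspace A z = {f. (f, z *\<^sub>C f) \<in> adj A}"

text \<open>\<open>complex_vector.dim\<close> is \<open>0\<close> on infinite-dimensional subspaces, so the value \<open>1\<close>
  means that the subspace is one-dimensional over the complex numbers.\<close>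

definition deficiency_indices :: "'h::chilbert_space op \<Rightarrow> nat \<times> nat" where
  "deficiency_indices A =
     (complex_vector.dim (deficiency_subspace A \<i>), complex_vector.dim (deficiency_subspace A (- \<i>)))"


section \<open>The rigged Hilbert space of a symmetric operator\<close>

definition plus_space :: "'h::chilbert_space op \<Rightarrow> 'h set" where
  "plus_space A = Domain (adj A)"

definition plus_inner :: "'h::chilbert_space op \<Rightarrow> 'h \<Rightarrow> 'h \<Rightarrow> complex" where
  "plus_inner A f g = cinner f g + cinner (op_app (adj A) f) (op_app (adj A) g)"

definition plus_norm :: "'h::chilbert_space op \<Rightarrow> 'h \<Rightarrow> real" where
  "plus_norm A f = sqrt (Re (plus_inner A f f))"

text \<open>The negative space consists of the bounded antilinear functionals on the positive space;
  \<open>F u\<close> is the pairing \<open>(F, u)\<close>. Functionals are extended by \<open>0\<close> outside the positive space,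
  so that equality of elements of the negative space is equality of functions.\<close>

definition minus_space :: "'h::chilbert_space op \<Rightarrow> ('h \<Rightarrow> complex) set" where
  "minus_space A = {F. (\<forall>u. u \<notin> plus_space A \<longrightarrow> F u = 0) \<and>
     (\<forall>u\<in>plus_space A. \<forall>v\<in>plus_space A. F (u + v) = F u + F v) \<and>
     (\<forall>c. \<forall>u\<in>plus_space A. F (c *\<^sub>C u) = cnj c * F u) \<and>
     (\<exists>C. \<forall>u\<in>plus_space A. cmod (F u) \<le> C * plus_norm A u)}"

definition minus_norm :: "'h::chilbert_space op \<Rightarrow> ('h \<Rightarrow> complex) \<Rightarrow> real" where
  "minus_norm A F = (SUP u\<in>{u \<in> plus_space A. plus_norm A u \<le> 1}. cmod (F u))"

text \<open>The embedding of the Hilbert space into the negative space.\<close>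

definition embed :: "'h::chilbert_space op \<Rightarrow> 'h \<Rightarrow> 'h \<Rightarrow> complex" where
  "embed A h = (\<lambda>u. if u \<in> plus_space A then cinner h u else 0)"

text \<open>An operator from the positive to the negative space is a function
  \<^typ>\<open>'h \<Rightarrow> 'h \<Rightarrow> complex\<close>; only its values on the positive space matter.\<close>

definition bounded_plus_minus ::
    "'h::chilbert_space op \<Rightarrow> ('h \<Rightarrow> 'h \<Rightarrow> complex) \<Rightarrow> bool" where
  "bounded_plus_minus A B \<longleftrightarrow> (\<forall>f\<in>plus_space A. B f \<in> minus_space A) \<and>
     (\<forall>f\<in>plus_space A. \<forall>g\<in>plus_space A. B (f + g) = (\<lambda>u. B f u + B g u)) \<and>
     (\<forall>c. \<forall>f\<in>plus_space A. B (c *\<^sub>C f) = (\<lambda>u. c * B f u)) \<and>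
     (\<exists>C. \<forall>f\<in>plus_space A. minus_norm A (B f) \<le> C * plus_norm A f)"

definition bounded_complex_minus ::
    "'h::chilbert_space op \<Rightarrow> (complex \<Rightarrow> 'h \<Rightarrow> complex) \<Rightarrow> bool" where
  "bounded_complex_minus A K \<longleftrightarrow> (\<forall>c. K c \<in> minus_space A) \<and>
     (\<forall>c d. K (c + d) = (\<lambda>u. K c u + K d u)) \<and>
     (\<forall>c d. K (c * d) = (\<lambda>u. c * K d u)) \<and>
     (\<exists>C. \<forall>c. minus_norm A (K c) \<le> C * cmod c)"

text \<open>The adjoints are determined by \<open>(B u, f) = (u, B\<^sup>* f)\<close> and
  \<open>(K c, f) = (c, K\<^sup>* f)\<close>, where \<open>K\<^sup>*\<close> maps the positive space to the complex numbers.\<close>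

definition rig_adj ::
    "'h::chilbert_space op \<Rightarrow> ('h \<Rightarrow> 'h \<Rightarrow> complex) \<Rightarrow> 'h \<Rightarrow> 'h \<Rightarrow> complex" where
  "rig_adj A B f = (\<lambda>u. if u \<in> plus_space A then cnj (B u f) else 0)"

definition channel_adj :: "(complex \<Rightarrow> 'h \<Rightarrow> complex) \<Rightarrow> 'h \<Rightarrow> complex" where
  "channel_adj K f = cnj (K 1 f)"

definition rig_Re ::
    "'h::chilbert_space op \<Rightarrow> ('h \<Rightarrow> 'h \<Rightarrow> complex) \<Rightarrow> 'h \<Rightarrow> 'h \<Rightarrow> complex" where
  "rig_Re A B f = (\<lambda>u. (B f u + rig_adj A B f u) / 2)"

definition rig_Im ::
    "'h::chilbert_space op \<Rightarrow> ('h \<Rightarrow> 'h \<Rightarrow> complex) \<Rightarrow> 'h \<Rightarrow> 'h \<Rightarrow> complex" where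
  "rig_Im A B f = (\<lambda>u. (B f u - rig_adj A B f u) / (2 * \<i>))"

definition quasi_kernel ::
    "'h::chilbert_space op \<Rightarrow> ('h \<Rightarrow> 'h \<Rightarrow> complex) \<Rightarrow> 'h op" where
  "quasi_kernel A B = {(f, h). f \<in> plus_space A \<and> B f = embed A h}"

definition extends_op ::
    "'h::chilbert_space op \<Rightarrow> 'h op \<Rightarrow> ('h \<Rightarrow> 'h \<Rightarrow> complex) \<Rightarrow> bool" where
  "extends_op A T B \<longleftrightarrow> (\<forall>(f, h)\<in>T. f \<in> plus_space A \<and> B f = embed A h)"


section \<open>L-systems\<close>

definition main_operator :: "'h::chilbert_space op \<Rightarrow> 'h op \<Rightarrow> bool" where
  "main_operator A T \<longleftrightarrow> linear_op T \<and> \<not> symmetric_op T \<and> A \<subseteq> T \<and> T \<subseteq> adj A \<and>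
     resolvent_set T \<noteq> {} \<and> Domain A = Domain T \<inter> Domain (adj T)"

definition star_extension ::
    "'h::chilbert_space op \<Rightarrow> 'h op \<Rightarrow> ('h \<Rightarrow> 'h \<Rightarrow> complex) \<Rightarrow> bool" where
  "star_extension A T B \<longleftrightarrow> bounded_plus_minus A B \<and>
     A \<subseteq> T \<and> extends_op A T B \<and>
     A \<subseteq> adj T \<and> extends_op A (adj T) (rig_adj A B) \<and>
     self_adjoint_op (quasi_kernel A (rig_Re A B))"

record 'h l_system =
  sym_op :: "'h op"
  main_op :: "'h op"
  state_op :: "'h \<Rightarrow> 'h \<Rightarrow> complex"
  channel_op :: "complex \<Rightarrow> 'h \<Rightarrow> complex"

definition is_l_system :: "'h::chilbert_space l_system \<Rightarrow> bool" where
  "is_l_system \<Theta> \<longleftrightarrow>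
     (let A = sym_op \<Theta>; T = main_op \<Theta>; B = state_op \<Theta>; K = channel_op \<Theta> in
       symmetric_op A \<and> closed A \<and> deficiency_indices A = (1, 1) \<and>
       main_operator A T \<and> star_extension A T B \<and>
       bounded_complex_minus A K \<and>
       (\<forall>f\<in>plus_space A. rig_Im A B f = K (channel_adj K f)) \<and>
       range K = rig_Im A B ` plus_space A)"

text \<open>The operator \<open>K\<^sup>*(Re B - z I)\<^sup>-\<^sup>1 K\<close> on the complex numbers is identified with its value
  at \<open>1\<close>. For \<open>z\<close> in the resolvent set of the quasi-kernel of \<open>Re B\<close>, the map \<open>Re B - z I\<close> is
  injective on the positive space, and its range contains that of \<open>K\<close>.\<close>

definition impedance :: "'h::chilbert_space l_system \<Rightarrow> complex \<Rightarrow> complex" where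
  "impedance \<Theta> z =
     (let A = sym_op \<Theta>; B = state_op \<Theta>; K = channel_op \<Theta> in
       channel_adj K
         (inv_into (plus_space A) (\<lambda>f u. rig_Re A B f u - z * embed A f u) (K 1)))"

definition realizes :: "'h::chilbert_space l_system \<Rightarrow> (complex \<Rightarrow> complex) \<Rightarrow> bool" where
  "realizes \<Theta> V \<longleftrightarrow> is_l_system \<Theta> \<and> (\<forall>z. Im z \<noteq> 0 \<longrightarrow> V z = impedance \<Theta> z)"


section \<open>The function classes\<close>

definition class_M :: "real \<Rightarrow> (complex \<Rightarrow> complex) set" where
  "class_M \<kappa>\<^sub>0 = {V. \<exists>\<mu> :: real measure. sets \<mu> = sets borel \<and> emeasure \<mu> UNIV = \<infinity> \<and>
     has_bochner_integral \<mu> (\<lambda>t. 1 / (1 + t\<^sup>2)) ((1 - \<kappa>\<^sub>0) / (1 + \<kappa>\<^sub>0)) \<and>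
     (\<forall>z. Im z \<noteq> 0 \<longrightarrow>
        V z = (LINT t|\<mu>. 1 / (of_real t - z) - of_real (t / (1 + t\<^sup>2))))}"

end

theory Submission
  imports Defs
begin

text \<open>
  Write \<open>\<chi>\<close> for \<open>K 1\<close> and \<open>\<Gamma>\<^sub>1\<close> for \<open>K\<^sup>*\<close>. Since the main operator is not symmetric and
  the deficiency indices are \<open>(1, 1)\<close>, the real part of the state-space operator has the form
  \<open>A\<^sup>* f + \<Gamma>\<^sub>0 f \<cdot> \<chi>\<close>, where \<open>\<Gamma>\<^sub>0\<close> is a functional on the positive space that vanishes
  on the domain of the quasi-kernel. Hermitian symmetry of the real part is then Green's formula, so
  \<open>(\<Gamma>\<^sub>0, \<Gamma>\<^sub>1)\<close> is a boundary triple for \<open>A\<^sup>*\<close>, and the impedance function is the Weyl function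
  \<open>V z = \<Gamma>\<^sub>1 f\<close>, where \<open>A\<^sup>* f = z f\<close> and \<open>\<Gamma>\<^sub>0 f = 1\<close>. Conversely every boundary triple comes
  from an L-system, whose main operator is the restriction of \<open>A\<^sup>*\<close> to \<open>\<Gamma>\<^sub>0 f = - \<i> \<Gamma>\<^sub>1 f\<close>.
  As \<open>Q\<close> is real, \<open>(\<Gamma>\<^sub>0, \<Gamma>\<^sub>1 + Q \<Gamma>\<^sub>0)\<close> is again a boundary triple, with Weyl function \<open>Q + V\<close>.
\<close>

section \<open>Complex Hilbert spaces\<close>

lemma Re_cinner_self: "Re (cinner x x) = (norm x)\<^sup>2" for x :: "'h::chilbert_space"
  by (simp add: Re_cinner power2_norm_eq_inner)

lemma cinner_self: "cinner x x = complex_of_real ((norm x)\<^sup>2)" for x :: "'h::chilbert_space"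
proof -
  have "Im (cinner x x) = 0"
    using arg_cong[OF cinner_commute[of x x], of Im] by simp
  then show ?thesis by (simp add: complex_eq_iff Re_cinner_self)
qed

lemma cinner_zero_left [simp]: "cinner 0 (x :: 'h::chilbert_space) = 0"
  using cinner_add_left[of 0 0 x] by simp

lemma cinner_zero_right [simp]: "cinner (x :: 'h::chilbert_space) 0 = 0"
  using cinner_commute[of x 0] by simp

lemma cinner_add_right: "cinner x (y + z) = cinner x y + cinner x z"
  for x :: "'h::chilbert_space"
  by (metis cinner_add_left cinner_commute complex_cnj_add)

lemma cinner_scaleC_right: "cinner x (a *\<^sub>C y) = cnj a * cinner x y"
  for x :: "'h::chilbert_space"
  by (metis cinner_commute cinner_scaleC_left complex_cnj_mult)

lemma cinner_diff_left: "cinner (x - y) z = cinner x z - cinner y z" for x :: "'h::chilbert_space"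
  using cinner_add_left[of "x - y" y z] by simp

lemma cinner_diff_right: "cinner x (y - z) = cinner x y - cinner x z" for x :: "'h::chilbert_space"
  using cinner_add_right[of x "y - z" z] by simp

lemma cinner_minus_left: "cinner (- x) y = - cinner x y" for x :: "'h::chilbert_space"
  using cinner_diff_left[of 0 x y] by simp

lemma cinner_minus_right: "cinner x (- y) = - cinner x y" for x :: "'h::chilbert_space"
  using cinner_diff_right[of x 0 y] by simp

lemma Im_cinner: "Im (cinner x y) = inner x (\<i> *\<^sub>C y)" for x :: "'h::chilbert_space"
  by (simp add: Re_cinner[symmetric] cinner_scaleC_right)

lemma norm_scaleC: "norm (a *\<^sub>C x) = cmod a * norm x" for x :: "'h::chilbert_space"
proof -
  have "complex_of_real ((norm (a *\<^sub>C x))\<^sup>2) = cinner (a *\<^sub>C x) (a *\<^sub>C x)"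
    by (simp only: cinner_self)
  also have "\<dots> = a * cnj a * cinner x x"
    by (simp add: cinner_scaleC_left cinner_scaleC_right)
  also have "\<dots> = complex_of_real ((cmod a * norm x)\<^sup>2)"
    by (simp add: cinner_self complex_mult_cnj cmod_power2 power_mult_distrib)
  finally have "(norm (a *\<^sub>C x))\<^sup>2 = (cmod a * norm x)\<^sup>2"
    using of_real_eq_iff by blast
  then show ?thesis by simp
qed

lemma norm_cinner_le: "cmod (cinner x y) \<le> 2 * (norm x * norm y)" for x :: "'h::chilbert_space"
proof -
  have "\<bar>Im (cinner x y)\<bar> \<le> norm x * norm y"
    using Cauchy_Schwarz_ineq2[of x "\<i> *\<^sub>C y"] by (simp add: Im_cinner norm_scaleC)
  moreover have "\<bar>Re (cinner x y)\<bar> \<le> norm x * norm y"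
    using Cauchy_Schwarz_ineq2[of x y] by (simp add: Re_cinner)
  ultimately show ?thesis using cmod_le[of "cinner x y"] by linarith
qed

lemma bounded_linear_scaleC: "bounded_linear (\<lambda>x :: 'h::chilbert_space. a *\<^sub>C x)"
proof (rule bounded_linear_intro[where K = "cmod a"])
  fix r :: real and x :: 'h
  show "a *\<^sub>C r *\<^sub>R x = r *\<^sub>R a *\<^sub>C x"
    by (simp add: scaleC_of_real[symmetric] scaleC_scaleC mult.commute)
qed (simp_all add: scaleC_add_right norm_scaleC mult.commute)

lemma bounded_linear_cinner_left: "bounded_linear (\<lambda>x :: 'h::chilbert_space. cinner x y)"
proof (rule bounded_linear_intro[where K = "2 * norm y"])
  fix r :: real and x :: 'h
  show "cinner (r *\<^sub>R x) y = r *\<^sub>R cinner x y"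
    by (simp add: scaleC_of_real[symmetric] cinner_scaleC_left scaleR_conv_of_real)
  show "cmod (cinner x y) \<le> norm x * (2 * norm y)"
    using norm_cinner_le[of x y] by (simp add: mult_ac)
qed (simp add: cinner_add_left)

lemma bounded_linear_cinner_right: "bounded_linear (\<lambda>y :: 'h::chilbert_space. cinner x y)"
  using bounded_linear_compose[OF bounded_linear_cnj bounded_linear_cinner_left[of x]]
  by (simp add: cinner_commute[symmetric])

lemma orthogonal_dense_eq_0:
  fixes h :: "'h::chilbert_space"
  assumes "closure S = UNIV" and "\<And>x. x \<in> S \<Longrightarrow> cinner h x = 0"
  shows "h = 0"
proof -
  have "closed {x. inner h x = 0}"
    by (intro closed_Collect_eq continuous_intros)
  moreover have "S \<subseteq> {x. inner h x = 0}"
    using assms(2) by (auto simp: Re_cinner[symmetric])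
  ultimately have "closure S \<subseteq> {x. inner h x = 0}" by (simp add: closure_minimal)
  then have "inner h h = 0" using assms(1) by blast
  then show ?thesis by simp
qed

text \<open>A minimising sequence for the distance from \<open>x\<close> to \<open>M\<close> is
  Cauchy by the parallelogram law, and its limit is the foot \<open>m\<close>. Orthogonality comes
  first for the real inner product, by varying along a line, and then for the complex one.\<close>

lemma closed_subspace_projection:
  fixes M :: "'h::chilbert_space set"
  assumes M: "complex_vector.subspace M" and "closed M"
  obtains m where "m \<in> M" and "\<And>n. n \<in> M \<Longrightarrow> cinner (x - m) n = 0"
proof -
  define d where "d = (INF m\<in>M. (norm (x - m))\<^sup>2)"
  have M0: "0 \<in> M" using M by (rule complex_vector.subspace_0)
  have bdd: "bdd_below ((\<lambda>m. (norm (x - m))\<^sup>2) ` M)"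
    by (rule bdd_belowI[of _ 0]) auto
  have d_le: "d \<le> (norm (x - m))\<^sup>2" if "m \<in> M" for m
    unfolding d_def using bdd that by (rule cINF_lower)
  have ex: "\<exists>m\<in>M. (norm (x - m))\<^sup>2 < d + e" if "e > 0" for e
    using that cINF_less_iff[OF _ bdd, of "d + e"] M0 unfolding d_def by auto
  have "\<forall>k. \<exists>m\<in>M. (norm (x - m))\<^sup>2 < d + inverse (real (Suc k))"
    by (intro allI ex) simp
  then obtain m where mM: "\<And>k. m k \<in> M"
    and mk: "\<And>k. (norm (x - m k))\<^sup>2 < d + inverse (real (Suc k))" by metis
  have scaleR_M: "r *\<^sub>R u \<in> M" if "u \<in> M" for r u
    using complex_vector.subspace_scale[OF M that, of "complex_of_real r"] by (simp add: scaleC_of_real)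
  \<comment> \<open>Parallelogram law for \<open>x - u\<close> and \<open>x - v\<close>: the
    midpoint of \<open>u\<close> and \<open>v\<close> stays in \<open>M\<close>, so its distance to
    \<open>x\<close> contributes at least \<open>4 * d\<close>.\<close>
  have par: "(norm (u - v))\<^sup>2 \<le> 2 * (norm (x - u))\<^sup>2 + 2 * (norm (x - v))\<^sup>2 - 4 * d"
    if "u \<in> M" "v \<in> M" for u v
  proof -
    have "(1/2) *\<^sub>R (u + v) \<in> M"
      using that M by (intro scaleR_M complex_vector.subspace_add)
    then have "4 * d \<le> 4 * (norm (x - (1/2) *\<^sub>R (u + v)))\<^sup>2" by (simp add: d_le)
    also have "\<dots> = (norm (2 *\<^sub>R (x - (1/2) *\<^sub>R (u + v))))\<^sup>2"
      by (simp add: power_mult_distrib)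
    also have "2 *\<^sub>R (x - (1/2) *\<^sub>R (u + v)) = (x - u) + (x - v)"
      by (simp add: algebra_simps scaleR_2)
    finally have "4 * d \<le> (norm ((x - u) + (x - v)))\<^sup>2" .
    moreover have "(norm ((x - u) + (x - v)))\<^sup>2 + (norm (u - v))\<^sup>2
        = 2 * (norm (x - u))\<^sup>2 + 2 * (norm (x - v))\<^sup>2"
      by (simp add: power2_norm_eq_inner algebra_simps inner_commute)
    ultimately show ?thesis by linarith
  qed
  have "Cauchy m"
  proof (rule metric_CauchyI)
    fix e :: real
    assume "0 < e"
    then have e: "0 < e\<^sup>2 / 4" by simp
    then obtain N where N: "inverse (real (Suc N)) < e\<^sup>2 / 4" using reals_Archimedean by blast
    have "dist (m j) (m k) < e" if "N \<le> j" "N \<le> k" for j k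
    proof -
      have *: "(norm (x - m i))\<^sup>2 < d + e\<^sup>2 / 4" if "N \<le> i" for i
      proof -
        have "inverse (real (Suc i)) \<le> inverse (real (Suc N))"
          using that by (intro le_imp_inverse_le) auto
        then show ?thesis using mk[of i] N by linarith
      qed
      have "(norm (m j - m k))\<^sup>2 < e\<^sup>2"
        using par[OF mM[of j] mM[of k]] *[OF that(1)] *[OF that(2)] by linarith
      then show ?thesis
        using \<open>0 < e\<close> by (simp add: dist_norm power_less_imp_less_base)
    qed
    then show "\<exists>N. \<forall>j\<ge>N. \<forall>k\<ge>N. dist (m j) (m k) < e" by blast
  qed
  then obtain p where p: "m \<longlonglongrightarrow> p" using Cauchy_convergent_iff convergent_def by blast
  have pM: "p \<in> M" using closed_sequentially[OF \<open>closed M\<close> _ p] mM by blast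
  have "(\<lambda>k. (norm (x - m k))\<^sup>2) \<longlonglongrightarrow> (norm (x - p))\<^sup>2"
    by (intro tendsto_intros p)
  moreover have "(\<lambda>k. d + inverse (real (Suc k))) \<longlonglongrightarrow> d + 0"
    by (intro tendsto_intros LIMSEQ_inverse_real_of_nat)
  ultimately have pd: "(norm (x - p))\<^sup>2 \<le> d"
    using mk by (intro LIMSEQ_le[of _ _ "\<lambda>k. d + inverse (real (Suc k))"]) (auto intro: less_imp_le)
  have orth: "inner (x - p) n = 0" if "n \<in> M" for n
  proof (cases "n = 0")
    case False
    \<comment> \<open>This \<open>t\<close> minimises the quadratic polynomial giving the squared
      distance from \<open>x\<close> to \<open>p + t n\<close>; minimality of \<open>p\<close> then
      forces the linear coefficient to vanish.\<close>
    define t where "t = inner (x - p) n / (norm n)\<^sup>2"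
    have "p + t *\<^sub>R n \<in> M" by (intro complex_vector.subspace_add[OF M] pM scaleR_M that)
    then have "(norm (x - p))\<^sup>2 \<le> (norm ((x - p) - t *\<^sub>R n))\<^sup>2"
      using d_le[of "p + t *\<^sub>R n"] pd unfolding diff_diff_eq by linarith
    also have "\<dots> = (norm (x - p))\<^sup>2 - 2 * t * inner (x - p) n + t\<^sup>2 * (norm n)\<^sup>2"
      unfolding power2_norm_eq_inner
      by (simp add: inner_diff_left inner_diff_right inner_commute power2_eq_square algebra_simps)
    also have "t\<^sup>2 * (norm n)\<^sup>2 = t * inner (x - p) n"
      using False by (simp add: t_def power2_eq_square)
    finally have "t * inner (x - p) n \<le> 0" by simp
    then have "(inner (x - p) n)\<^sup>2 / (norm n)\<^sup>2 \<le> 0" by (simp add: t_def power2_eq_square)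
    then show ?thesis using False by (simp add: divide_le_0_iff)
  qed simp
  show thesis
  proof
    fix n assume "n \<in> M"
    \<comment> \<open>The imaginary part of \<open>cinner\<close> is the real inner product with
      \<open>\<i>\<close> times the vector, so real orthogonality to both \<open>n\<close> and
      \<open>\<i>\<close> times \<open>n\<close> suffices.\<close>
    then have "\<i> *\<^sub>C n \<in> M" using M by (intro complex_vector.subspace_scale)
    then show "cinner (x - p) n = 0"
      using orth \<open>n \<in> M\<close> by (simp add: complex_eq_iff Re_cinner Im_cinner)
  qed (rule pM)
qed


section \<open>Unbounded operators\<close>

lemma linear_opD:
  assumes "linear_op G"
  shows linear_op_unique: "(x, y) \<in> G \<Longrightarrow> (x, y') \<in> G \<Longrightarrow> y = y'"
    and linear_op_zero: "(0, 0) \<in> G"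
    and linear_op_add: "(x, y) \<in> G \<Longrightarrow> (x', y') \<in> G \<Longrightarrow> (x + x', y + y') \<in> G"
    and linear_op_scaleC: "(x, y) \<in> G \<Longrightarrow> (c *\<^sub>C x, c *\<^sub>C y) \<in> G"
  using assms unfolding linear_op_def single_valued_def by blast+

lemma linear_op_diff:
  assumes "linear_op G" "(x, y) \<in> G" "(x', y') \<in> G"
  shows "(x - x', y - y') \<in> G"
  using linear_op_add[OF assms(1,2) linear_op_scaleC[OF assms(1,3), of "-1"]] by simp

lemma adjI: "(\<And>x y. (x, y) \<in> G \<Longrightarrow> cinner y u = cinner x v) \<Longrightarrow> (u, v) \<in> adj G"
  by (auto simp: adj_def)

lemma adjD: "(u, v) \<in> adj G \<Longrightarrow> (x, y) \<in> G \<Longrightarrow> cinner y u = cinner x v"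
  by (auto simp: adj_def)

lemma adj_antimono: "G \<subseteq> H \<Longrightarrow> adj H \<subseteq> adj G"
  by (auto simp: adj_def)

lemma linear_op_adj:
  assumes "densely_defined G"
  shows "linear_op (adj G)"
proof -
  have "v = v'" if "(u, v) \<in> adj G" "(u, v') \<in> adj G" for u v v'
  proof -
    have "cinner (v - v') x = 0" if "x \<in> Domain G" for x
      using that adjD[OF \<open>(u, v) \<in> adj G\<close>] adjD[OF \<open>(u, v') \<in> adj G\<close>]
      by (metis Domain.cases cinner_commute cinner_diff_right complex_cnj_zero diff_self)
    then show ?thesis
      using orthogonal_dense_eq_0[of "Domain G" "v - v'"] assms by (auto simp: densely_defined_def)
  qed
  then show ?thesis
    unfolding linear_op_def single_valued_def
    by (auto simp: cinner_add_right cinner_scaleC_right adjD intro!: adjI)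
qed

lemma closed_adj: "closed (adj G)" for G :: "'h::chilbert_space op"
proof -
  have "adj G = (\<Inter>(x, y)\<in>G. {w. cinner y (fst w) = cinner x (snd w)})"
    by (auto simp: adj_def)
  moreover have "closed {w. cinner y (fst w) = cinner x (snd w)}" for x y :: 'h
    by (intro closed_Collect_eq bounded_linear.continuous_on[OF bounded_linear_cinner_right]
        continuous_on_fst continuous_on_snd continuous_on_id)
  ultimately show ?thesis by auto
qed

text \<open>Pair \<open>y - z f\<close> with \<open>f\<close>. The sign hypothesis keeps the two
  terms of the imaginary part from cancelling, so it has modulus at least
  \<open>\<bar>Im z\<bar>\<close> times the square of \<open>norm f\<close>; Cauchy-Schwarz
  finishes. This covers symmetric operators, where \<open>Im (cinner y f)\<close> is 0, and
  dissipative ones with \<open>z\<close> in the lower half-plane.\<close>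

lemma dissipative_lower_bound:
  fixes f y :: "'h::chilbert_space"
  assumes "Im (cinner y f) * Im z \<le> 0"
  shows "\<bar>Im z\<bar> * norm f \<le> norm (y - z *\<^sub>C f)"
proof (cases "f = 0")
  case False
  have "Im (cinner (y - z *\<^sub>C f) f) = Im (cinner y f) - Im z * (norm f)\<^sup>2"
    by (simp add: cinner_diff_left cinner_scaleC_left cinner_self)
  then have "\<bar>Im (cinner (y - z *\<^sub>C f) f)\<bar> = \<bar>Im (cinner y f) - Im z * (norm f)\<^sup>2\<bar>" by simp
  moreover have "\<bar>Im z\<bar> * (norm f)\<^sup>2 \<le> \<bar>Im (cinner y f) - Im z * (norm f)\<^sup>2\<bar>"
  proof (cases "Im z \<ge> 0")
    case True
    then show ?thesis using assms
      by (cases "Im z = 0") (auto simp: mult_le_0_iff abs_if)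
  next
    case False
    then have "Im (cinner y f) \<ge> 0" using assms by (simp add: mult_le_0_iff)
    moreover have "Im z * (norm f)\<^sup>2 \<le> 0" using False by (simp add: mult_le_0_iff)
    ultimately show ?thesis using False by (simp add: abs_if)
  qed
  moreover have "\<bar>Im (cinner (y - z *\<^sub>C f) f)\<bar> \<le> norm (y - z *\<^sub>C f) * norm f"
    using Cauchy_Schwarz_ineq2[of "y - z *\<^sub>C f" "\<i> *\<^sub>C f"] by (simp add: Im_cinner norm_scaleC)
  ultimately have "\<bar>Im z\<bar> * norm f * norm f \<le> norm (y - z *\<^sub>C f) * norm f"
    by (simp add: power2_eq_square mult.assoc)
  then show ?thesis using False by simp
qed simp

lemma symmetric_Im_cinner:
  assumes "G \<subseteq> adj G" "(f, y) \<in> G"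
  shows "Im (cinner y f) = 0"
proof -
  have "cinner y f = cinner f y" using assms adjD by blast
  then have "Im (cinner y f) = - Im (cinner y f)" by (metis cinner_commute cnj.simps(2))
  then show ?thesis by simp
qed

lemma range_shift_subspace:
  assumes "linear_op G"
  shows "complex_vector.subspace {y - z *\<^sub>C f |f y. (f, y) \<in> G}"
proof (rule complex_vector.subspaceI)
  show "0 \<in> {y - z *\<^sub>C f |f y. (f, y) \<in> G}"
    using linear_op_zero[OF assms] complex_vector.scale_zero_right diff_zero
    by (metis (mono_tags, lifting) mem_Collect_eq)
next
  fix u v assume "u \<in> {y - z *\<^sub>C f |f y. (f, y) \<in> G}" "v \<in> {y - z *\<^sub>C f |f y. (f, y) \<in> G}"
  then obtain f y f' y' where *: "(f, y) \<in> G" "u = y - z *\<^sub>C f" "(f', y') \<in> G" "v = y' - z *\<^sub>C f'"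
    by auto
  then have "u + v = (y + y') - z *\<^sub>C (f + f')" by (simp add: scaleC_add_right)
  then show "u + v \<in> {y - z *\<^sub>C f |f y. (f, y) \<in> G}"
    using linear_op_add[OF assms *(1,3)] by blast
next
  fix c u assume "u \<in> {y - z *\<^sub>C f |f y. (f, y) \<in> G}"
  then obtain f y where *: "(f, y) \<in> G" "u = y - z *\<^sub>C f" by auto
  then have "c *\<^sub>C u = c *\<^sub>C y - z *\<^sub>C c *\<^sub>C f"
    by (simp add: complex_vector.scale_right_diff_distrib scaleC_scaleC mult.commute)
  then show "c *\<^sub>C u \<in> {y - z *\<^sub>C f |f y. (f, y) \<in> G}"
    using linear_op_scaleC[OF assms *(1)] by blast
qed

text \<open>The lower bound, applied to differences, makes \<open>f\<close> Cauchy as soon as the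
  images \<open>w\<close> are. Then \<open>y\<close>, being \<open>w + z f\<close>, converges as
  well, and closedness of the graph applies.\<close>

lemma range_shift_closed:
  fixes G :: "'h::chilbert_space op"
  assumes lin: "linear_op G" and "closed G" and sym: "G \<subseteq> adj G" and z: "Im z \<noteq> 0"
  shows "closed {y - z *\<^sub>C f |f y. (f, y) \<in> G}"
proof (subst closed_sequential_limits, intro allI impI, elim conjE)
  fix w l assume "\<forall>n::nat. w n \<in> {y - z *\<^sub>C f |f y. (f, y) \<in> G}" and l: "w \<longlonglongrightarrow> l"
  then have "\<forall>n. \<exists>f y. (f, y) \<in> G \<and> w n = y - z *\<^sub>C f" by blast
  then obtain f y where fy: "\<And>n. (f n, y n) \<in> G" and w: "\<And>n. w n = y n - z *\<^sub>C f n" by metis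
  have bnd: "\<bar>Im z\<bar> * norm (f j - f k) \<le> norm (w j - w k)" for j k
  proof -
    have "\<bar>Im z\<bar> * norm (f j - f k) \<le> norm ((y j - y k) - z *\<^sub>C (f j - f k))"
      using symmetric_Im_cinner[OF sym linear_op_diff[OF lin fy[of j] fy[of k]]]
      by (intro dissipative_lower_bound) simp
    then show ?thesis
      by (simp add: w complex_vector.scale_right_diff_distrib algebra_simps)
  qed
  have "Cauchy f"
  proof (rule metric_CauchyI)
    fix e :: real assume "0 < e"
    then have "0 < \<bar>Im z\<bar> * e" using z by simp
    then obtain N where N: "\<And>j k. N \<le> j \<Longrightarrow> N \<le> k \<Longrightarrow> dist (w j) (w k) < \<bar>Im z\<bar> * e"
      using metric_CauchyD[OF LIMSEQ_imp_Cauchy[OF l]] by blast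
    have "dist (f j) (f k) < e" if "N \<le> j" "N \<le> k" for j k
    proof -
      have "\<bar>Im z\<bar> * norm (f j - f k) < \<bar>Im z\<bar> * e"
        using bnd[of j k] N[OF that] by (simp add: dist_norm)
      then show ?thesis using z by (simp add: dist_norm)
    qed
    then show "\<exists>N. \<forall>j\<ge>N. \<forall>k\<ge>N. dist (f j) (f k) < e" by blast
  qed
  then obtain p where p: "f \<longlonglongrightarrow> p" using Cauchy_convergent_iff convergent_def by blast
  have "(\<lambda>n. w n + z *\<^sub>C f n) \<longlonglongrightarrow> l + z *\<^sub>C p"
    by (intro tendsto_add l bounded_linear.tendsto[OF bounded_linear_scaleC] p)
  then have "(\<lambda>n. (f n, y n)) \<longlonglongrightarrow> (p, l + z *\<^sub>C p)"
    by (intro tendsto_Pair p) (simp add: w)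
  then have "(p, l + z *\<^sub>C p) \<in> G"
    using closed_sequentially[OF \<open>closed G\<close>, of "\<lambda>n. (f n, y n)"] fy by simp
  then show "l \<in> {y - z *\<^sub>C f |f y. (f, y) \<in> G}" by force
qed

text \<open>The orthogonal complement of the range of \<open>G - z\<close> is the eigenspace of
  \<open>adj G\<close> at \<open>cnj z\<close>. Projecting \<open>h\<close> onto the closed range
  therefore leaves a defect vector as remainder.\<close>

lemma range_shift_projection:
  fixes G :: "'h::chilbert_space op"
  assumes "linear_op G" "closed G" "G \<subseteq> adj G" "Im z \<noteq> 0"
  obtains f y where "(f, y) \<in> G"
    and "(h - (y - z *\<^sub>C f), cnj z *\<^sub>C (h - (y - z *\<^sub>C f))) \<in> adj G"
proof -
  define M where "M = {y - z *\<^sub>C f |f y. (f, y) \<in> G}"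
  have "complex_vector.subspace M" "closed M"
    unfolding M_def using range_shift_subspace range_shift_closed assms by blast+
  then obtain m where m: "m \<in> M" and orth: "\<And>n. n \<in> M \<Longrightarrow> cinner (h - m) n = 0"
    using closed_subspace_projection[of M h] by blast
  obtain f y where fy: "(f, y) \<in> G" "m = y - z *\<^sub>C f" using m by (auto simp: M_def)
  have "(h - m, cnj z *\<^sub>C (h - m)) \<in> adj G"
  proof (rule adjI)
    fix u v assume "(u, v) \<in> G"
    then have "cinner (h - m) (v - z *\<^sub>C u) = 0" using orth by (auto simp: M_def)
    then have "cinner (v - z *\<^sub>C u) (h - m) = 0" by (metis cinner_commute complex_cnj_zero)
    then show "cinner v (h - m) = cinner u (cnj z *\<^sub>C (h - m))"
      by (simp add: cinner_diff_left[of v] cinner_scaleC_left cinner_scaleC_right)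
  qed
  then show thesis using that fy by blast
qed

lemma self_adjoint_shift_inj:
  assumes "self_adjoint_op G" "Im z \<noteq> 0" "(f, z *\<^sub>C f) \<in> G"
  shows "f = 0"
proof -
  have "\<bar>Im z\<bar> * norm f \<le> norm (z *\<^sub>C f - z *\<^sub>C f)"
    using symmetric_Im_cinner[of G f "z *\<^sub>C f"] assms
    by (intro dissipative_lower_bound) (simp add: self_adjoint_op_def)
  then show ?thesis using assms(2) by (simp add: mult_le_0_iff)
qed

text \<open>The remainder of the projection is an eigenvector of \<open>adj G = G\<close> at a
  non-real point, hence zero.\<close>

lemma self_adjoint_shift_surj:
  assumes sa: "self_adjoint_op G" and z: "Im z \<noteq> 0"
  obtains f y where "(f, y) \<in> G" "y - z *\<^sub>C f = h"
proof -
  have G: "linear_op G" "adj G = G" using sa by (auto simp: self_adjoint_op_def)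
  obtain f y where fy: "(f, y) \<in> G"
    and "(h - (y - z *\<^sub>C f), cnj z *\<^sub>C (h - (y - z *\<^sub>C f))) \<in> adj G"
    by (rule range_shift_projection[of G z h]) (use G closed_adj[of G] z in auto)
  then have "h - (y - z *\<^sub>C f) = 0"
    using self_adjoint_shift_inj[OF sa, of "cnj z" "h - (y - z *\<^sub>C f)"] G z by simp
  then show thesis using that fy by simp
qed

text \<open>This is the inclusion of \<open>A\<^sup>*\<^sup>*\<close> in \<open>A\<close> for closed symmetric \<open>A\<close>, obtained from the closed range
  of \<open>A + \<i>\<close> instead of a projection onto the graph.\<close>

lemma symmetric_op_kernel_eq:
  assumes A: "symmetric_op A" "closed A" and f: "(f, y) \<in> adj A"
    and green: "\<And>u v. (u, v) \<in> adj A \<Longrightarrow> cinner y u = cinner f v"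
  shows "(f, y) \<in> A"
proof -
  have lin: "linear_op A" "A \<subseteq> adj A" and lin': "linear_op (adj A)"
    using A linear_op_adj by (auto simp: symmetric_op_def)
  obtain a b where ab: "(a, b) \<in> A"
    and n: "((y + \<i> *\<^sub>C f) - (b - (- \<i>) *\<^sub>C a), cnj (- \<i>) *\<^sub>C ((y + \<i> *\<^sub>C f) - (b - (- \<i>) *\<^sub>C a))) \<in> adj A"
    by (rule range_shift_projection[OF lin(1) A(2) lin(2), of "- \<i>" "y + \<i> *\<^sub>C f"]) auto
  \<comment> \<open>Subtracting \<open>(a, b)\<close>, which lies in \<open>A\<close>, preserves the
    vanishing of the Green form. The remainder of the projection becomes \<open>w + \<i> v\<close>,
    an eigenvector of \<open>adj A\<close> at \<open>\<i>\<close>.\<close>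
  define v where "v = f - a"
  define w where "w = y - b"
  have vw: "(v, w) \<in> adj A"
    unfolding v_def w_def using f ab lin by (intro linear_op_diff lin') auto
  have green': "cinner w u = cinner v u'" if "(u, u') \<in> adj A" for u u'
    using green[OF that] adjD[OF that ab] by (simp add: v_def w_def cinner_diff_left)
  have "(y + \<i> *\<^sub>C f) - (b - (- \<i>) *\<^sub>C a) = w + \<i> *\<^sub>C v"
    by (simp add: v_def w_def complex_vector.scale_right_diff_distrib)
  with n have n': "(w + \<i> *\<^sub>C v, \<i> *\<^sub>C (w + \<i> *\<^sub>C v)) \<in> adj A" by simp
  \<comment> \<open>Testing the pair \<open>(v, w)\<close> against this eigenvector yields its
    squared norm, so it vanishes.\<close>
  have "cinner w (w + \<i> *\<^sub>C v) = cinner v (\<i> *\<^sub>C (w + \<i> *\<^sub>C v))" by (rule green'[OF n'])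
  then have "cinner (w + \<i> *\<^sub>C v) (w + \<i> *\<^sub>C v) = 0"
    by (simp add: cinner_add_left cinner_scaleC_left cinner_scaleC_right)
  then have "w + \<i> *\<^sub>C v = 0" by (simp add: cinner_self)
  then have w: "w = (- \<i>) *\<^sub>C v" by (simp add: eq_neg_iff_add_eq_0)
  \<comment> \<open>Now \<open>w\<close> is \<open>- \<i>\<close> times \<open>v\<close>, so testing
    \<open>(v, w)\<close> against itself equates \<open>- \<i>\<close> and \<open>\<i>\<close> times
    the squared norm of \<open>v\<close>.\<close>
  have "cinner w v = cinner v w" by (rule green'[OF vw])
  then have "cinner v v = 0"
    by (simp add: w cinner_minus_left cinner_minus_right cinner_scaleC_left cinner_scaleC_right)
  then have "v = 0" by (simp add: cinner_self)
  then have "f = a" "y = b" using w by (auto simp: v_def w_def)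
  then show ?thesis using ab by simp
qed


section \<open>The positive space with its graph norm\<close>

lemma plus_space_iff: "f \<in> plus_space A \<longleftrightarrow> (\<exists>y. (f, y) \<in> adj A)"
  by (auto simp: plus_space_def)

lemma op_app_eq: "linear_op G \<Longrightarrow> (x, y) \<in> G \<Longrightarrow> op_app G x = y"
  unfolding op_app_def by (rule the_equality) (simp_all add: linear_op_unique[of G x])

locale dense_symmetric =
  fixes A :: "'h::chilbert_space op"
  assumes symmetric: "symmetric_op A"
begin

abbreviation S where "S \<equiv> op_app (adj A)"

abbreviation D where "D \<equiv> plus_space A"

lemma lin: "linear_op A" and dense: "closure (Domain A) = UNIV" and sub: "A \<subseteq> adj A"
  and lin_adj: "linear_op (adj A)"
  using symmetric linear_op_adj by (auto simp: symmetric_op_def densely_defined_def)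

lemma adj_iff: "(f, y) \<in> adj A \<longleftrightarrow> f \<in> D \<and> S f = y"
  using op_app_eq[OF lin_adj, of f] plus_space_iff[of f A] by metis

lemma adj_S: "f \<in> D \<Longrightarrow> (f, S f) \<in> adj A"
  by (simp add: adj_iff)

lemma D_A: "(f, y) \<in> A \<Longrightarrow> f \<in> D \<and> S f = y"
  using subsetD[OF sub, of "(f, y)"] adj_iff[of f y] by simp

lemma D_subspace: "complex_vector.subspace D"
proof (rule complex_vector.subspaceI)
  show "0 \<in> D" using linear_op_zero[OF lin_adj] by (auto simp: plus_space_def)
next
  fix x y assume "x \<in> D" "y \<in> D"
  then show "x + y \<in> D" using linear_op_add[OF lin_adj] unfolding plus_space_iff by meson
next
  fix c x assume "x \<in> D"
  then show "c *\<^sub>C x \<in> D" using linear_op_scaleC[OF lin_adj] unfolding plus_space_iff by meson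
qed

lemmas D_0 [simp, intro] = complex_vector.subspace_0[OF D_subspace]
lemmas D_add [simp, intro] = complex_vector.subspace_add[OF D_subspace]
lemmas D_diff [simp, intro] = complex_vector.subspace_diff[OF D_subspace]
lemmas D_scale [simp, intro] = complex_vector.subspace_scale[OF D_subspace]

lemma S_add: "f \<in> D \<Longrightarrow> g \<in> D \<Longrightarrow> S (f + g) = S f + S g"
  using linear_op_add[OF lin_adj adj_S adj_S, of f g] by (simp add: adj_iff)

lemma S_diff: "f \<in> D \<Longrightarrow> g \<in> D \<Longrightarrow> S (f - g) = S f - S g"
  using linear_op_diff[OF lin_adj adj_S adj_S, of f g] by (simp add: adj_iff)

lemma S_scale: "f \<in> D \<Longrightarrow> S (c *\<^sub>C f) = c *\<^sub>C S f"
  using linear_op_scaleC[OF lin_adj adj_S, of f] by (simp add: adj_iff)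

lemma plus_norm_eq: "plus_norm A f = sqrt ((norm f)\<^sup>2 + (norm (S f))\<^sup>2)"
  by (simp add: plus_norm_def plus_inner_def cinner_self)

lemma norm_le_plus_norm: "norm f \<le> plus_norm A f" "norm (S f) \<le> plus_norm A f"
  unfolding plus_norm_eq by (rule real_le_rsqrt, simp)+

lemma plus_norm_nonneg: "0 \<le> plus_norm A f"
  by (simp add: plus_norm_eq)

lemma minus_norm_le:
  assumes "\<And>u. u \<in> D \<Longrightarrow> cmod (F u) \<le> C * plus_norm A u" and "0 \<le> C"
  shows "minus_norm A F \<le> C"
  unfolding minus_norm_def
proof (rule cSUP_least)
  \<comment> \<open>Zero lies in the unit ball, so the supremum runs over a nonempty set and is at
    most any upper bound.\<close>
  have "S 0 = 0" using S_scale[of 0 0] by simp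
  then have "plus_norm A 0 \<le> 1" by (simp add: plus_norm_eq)
  then show "{u \<in> D. plus_norm A u \<le> 1} \<noteq> {}" by blast
next
  fix u assume "u \<in> {u \<in> D. plus_norm A u \<le> 1}"
  then show "cmod (F u) \<le> C"
    using assms(1)[of u] mult_left_mono[of "plus_norm A u" 1 C] assms(2) by simp
qed

lemma deficiency_line:
  assumes "deficiency_indices A = (1, 1)"
  obtains g where "g \<noteq> 0" "(g, \<i> *\<^sub>C g) \<in> adj A"
    and "\<And>f. (f, \<i> *\<^sub>C f) \<in> adj A \<Longrightarrow> \<exists>c. f = c *\<^sub>C g"
proof -
  let ?N = "deficiency_subspace A \<i>"
  obtain B where B: "B \<subseteq> ?N" "\<not> complex_vector.dependent B" "?N \<subseteq> complex_vector.span B"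
    "card B = complex_vector.dim ?N"
    using complex_vector.basis_exists by blast
  then have "card B = 1" using assms by (simp add: deficiency_indices_def)
  then obtain g where g: "B = {g}" by (auto simp: card_1_singleton_iff)
  show thesis
  proof
    show "g \<noteq> 0" using B(2) g complex_vector.dependent_zero by blast
    show "(g, \<i> *\<^sub>C g) \<in> adj A" using B(1) g by (simp add: deficiency_subspace_def)
    fix f assume "(f, \<i> *\<^sub>C f) \<in> adj A"
    then have "f \<in> complex_vector.span {g}" using B(3) g by (auto simp: deficiency_subspace_def)
    then show "\<exists>c. f = c *\<^sub>C g" by (auto simp: complex_vector.span_singleton)
  qed
qed

end

section \<open>Boundary triples\<close>

text \<open>Surjectivity of the pair \<open>(G0, G1)\<close> onto two-dimensional complex space is
  stated through preimages of the two unit vectors. Linearity is asked for on the positive space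
  alone, since the functions are total on \<open>'h\<close>. Continuity is imposed on
  \<open>G1\<close>; that of \<open>G0\<close> is derived in \<open>G0_bounded\<close>.\<close>

locale boundary_triple = dense_symmetric A for A :: "'h::chilbert_space op" +
  fixes G0 G1 :: "'h \<Rightarrow> complex"
  assumes closed: "closed A"
    and G0_add: "f \<in> plus_space A \<Longrightarrow> g \<in> plus_space A \<Longrightarrow> G0 (f + g) = G0 f + G0 g"
    and G0_scale: "f \<in> plus_space A \<Longrightarrow> G0 (c *\<^sub>C f) = c * G0 f"
    and G1_add: "f \<in> plus_space A \<Longrightarrow> g \<in> plus_space A \<Longrightarrow> G1 (f + g) = G1 f + G1 g"
    and G1_scale: "f \<in> plus_space A \<Longrightarrow> G1 (c *\<^sub>C f) = c * G1 f"
    and green: "f \<in> plus_space A \<Longrightarrow> g \<in> plus_space A \<Longrightarrow>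
      cinner (op_app (adj A) f) g - cinner f (op_app (adj A) g)
        = G1 f * cnj (G0 g) - G0 f * cnj (G1 g)"
    and surj0: "\<exists>f\<in>plus_space A. G0 f = 1 \<and> G1 f = 0"
    and surj1: "\<exists>f\<in>plus_space A. G0 f = 0 \<and> G1 f = 1"
    and G1_bounded: "\<exists>C. \<forall>f\<in>plus_space A. cmod (G1 f) \<le> C * plus_norm A f"
begin

lemma G0_zero: "G0 0 = 0" and G1_zero: "G1 0 = 0"
  using G0_scale[of 0 0] G1_scale[of 0 0] by simp_all

lemma G0_diff: "f \<in> D \<Longrightarrow> g \<in> D \<Longrightarrow> G0 (f - g) = G0 f - G0 g"
  using G0_add[of "f - g" g] by simp

lemma G1_diff: "f \<in> D \<Longrightarrow> g \<in> D \<Longrightarrow> G1 (f - g) = G1 f - G1 g"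
  using G1_add[of "f - g" g] by simp

lemma bounded_functional_nonneg:
  assumes "\<forall>f\<in>D. cmod (F f) \<le> C * plus_norm A f"
  obtains C' where "0 \<le> C'" "\<And>f. f \<in> D \<Longrightarrow> cmod (F f) \<le> C' * plus_norm A f"
proof
  fix f assume "f \<in> D"
  then have "cmod (F f) \<le> C * plus_norm A f" using assms by blast
  also have "\<dots> \<le> \<bar>C\<bar> * plus_norm A f" by (intro mult_right_mono plus_norm_nonneg) simp
  finally show "cmod (F f) \<le> \<bar>C\<bar> * plus_norm A f" .
qed simp

text \<open>Green's formula against a fixed \<open>p\<close> with boundary values
  \<open>(0, 1)\<close> expresses \<open>G0 f\<close> by inner products of \<open>f\<close> and
  \<open>S f\<close> with fixed vectors.\<close>

lemma G0_bounded: "\<exists>C. \<forall>f\<in>D. cmod (G0 f) \<le> C * plus_norm A f"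
proof -
  obtain p where p: "p \<in> D" "G0 p = 0" "G1 p = 1" using surj1 by blast
  have "cmod (G0 f) \<le> (2 * norm p + 2 * norm (S p)) * plus_norm A f" if "f \<in> D" for f
  proof -
    have "G0 f = cinner f (S p) - cinner (S f) p"
      using green[OF that p(1)] p by (simp add: algebra_simps)
    then have "cmod (G0 f) \<le> cmod (cinner f (S p)) + cmod (cinner (S f) p)"
      by (simp add: norm_triangle_ineq4)
    also have "\<dots> \<le> 2 * (norm f * norm (S p)) + 2 * (norm (S f) * norm p)"
      by (intro add_mono norm_cinner_le)
    also have "\<dots> \<le> 2 * (plus_norm A f * norm (S p)) + 2 * (plus_norm A f * norm p)"
      by (intro add_mono mult_left_mono mult_right_mono norm_le_plus_norm) auto
    finally show ?thesis by (simp add: algebra_simps)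
  qed
  then show ?thesis by blast
qed

text \<open>The parameter \<open>s = 0\<close> gives the quasi-kernel, \<open>s = - \<i>\<close> the main operator, and \<open>s = \<i>\<close> the
  adjoint of the main operator.\<close>

definition extension :: "complex \<Rightarrow> 'h op" where
  "extension s = {(f, y) \<in> adj A. G0 f = s * G1 f}"

lemma extension_iff: "(f, y) \<in> extension s \<longleftrightarrow> f \<in> D \<and> S f = y \<and> G0 f = s * G1 f"
  by (auto simp: extension_def adj_iff)

lemma extension_sub_adj: "extension s \<subseteq> adj A"
  by (auto simp: extension_def)

lemma Domain_extension: "Domain (extension s) = {f \<in> D. G0 f = s * G1 f}"
  by (auto simp: extension_iff)

lemma linear_op_extension: "linear_op (extension s)"
proof -
  have "S 0 = 0" using S_scale[of 0 0] by simp
  then show ?thesis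
    unfolding linear_op_def single_valued_def
    by (auto simp: extension_iff S_add S_scale G0_add G1_add G0_scale G1_scale G0_zero G1_zero algebra_simps)
qed

text \<open>For \<open>f\<close> in the domain of \<open>A\<close> the Green form vanishes against
  every vector, in particular against those with boundary values \<open>(0, 1)\<close> and
  \<open>(1, 0)\<close>. Conversely, zero boundary values annihilate the Green form, which is the
  criterion of \<open>symmetric_op_kernel_eq\<close>.\<close>

lemma boundary_zero_iff: "(f, y) \<in> A \<longleftrightarrow> (f, y) \<in> adj A \<and> G0 f = 0 \<and> G1 f = 0"
proof (intro iffI conjI)
  assume f: "(f, y) \<in> A"
  then show adj: "(f, y) \<in> adj A" using sub by blast
  have fD: "f \<in> D" "S f = y" using f D_A by auto
  have *: "G1 f * cnj (G0 u) - G0 f * cnj (G1 u) = 0" if "u \<in> D" for u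
    using green[OF fD(1) that] adjD[OF adj_S[OF that] f] fD by simp
  show "G0 f = 0" using surj1 * by fastforce
  show "G1 f = 0" using surj0 * by fastforce
next
  assume f: "(f, y) \<in> adj A \<and> G0 f = 0 \<and> G1 f = 0"
  show "(f, y) \<in> A"
  proof (rule symmetric_op_kernel_eq[OF symmetric closed])
    fix u v assume "(u, v) \<in> adj A"
    then show "cinner y u = cinner f v" using green[of f u] f by (auto simp: adj_iff)
  qed (use f in blast)
qed

lemma A_sub_extension: "A \<subseteq> extension s"
  using boundary_zero_iff by (auto simp: extension_def)

lemma dense_extension: "densely_defined (extension s)"
proof -
  have "closure (Domain A) \<subseteq> closure (Domain (extension s))"
    by (intro closure_mono Domain_mono A_sub_extension)
  then show ?thesis using dense by (auto simp: densely_defined_def)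
qed

lemma extension_witness: obtains f where "f \<in> D" "G0 f = s" "G1 f = 1"
proof -
  obtain p q where "p \<in> D" "G0 p = 0" "G1 p = 1" "q \<in> D" "G0 q = 1" "G1 q = 0"
    using surj0 surj1 by blast
  then show thesis using that[of "p + s *\<^sub>C q"]
    by (simp add: G0_add G1_add G0_scale G1_scale)
qed

text \<open>Modulo \<open>A\<close> the extension is the line spanned by the boundary values
  \<open>(s, 1)\<close>, and the adjoint is its annihilator under the Green form. Testing with one
  vector of these boundary values gives the condition with \<open>cnj s\<close>.\<close>

lemma adj_extension: "adj (extension s) = extension (cnj s)"
proof (intro set_eqI, clarify, intro iffI)
  fix u v assume uv: "(u, v) \<in> adj (extension s)"
  then have "(u, v) \<in> adj A" using adj_antimono[OF A_sub_extension] by blast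
  then have u: "u \<in> D" "S u = v" by (auto simp: adj_iff)
  obtain f where f: "f \<in> D" "G0 f = s" "G1 f = 1" using extension_witness .
  then have "(f, S f) \<in> extension s" by (simp add: extension_iff)
  then have "cinner (S f) u = cinner f v" using uv adjD by blast
  then have "cnj (G0 u) = s * cnj (G1 u)" using green[OF f(1) u(1)] f u by simp
  then have "G0 u = cnj s * G1 u" by (metis complex_cnj_cnj complex_cnj_mult)
  then show "(u, v) \<in> extension (cnj s)" using u by (simp add: extension_iff)
next
  fix u v assume "(u, v) \<in> extension (cnj s)"
  then have u: "u \<in> D" "S u = v" "G0 u = cnj s * G1 u" by (auto simp: extension_iff)
  show "(u, v) \<in> adj (extension s)"
  proof (rule adjI)
    fix x y assume "(x, y) \<in> extension s"
    then have "x \<in> D" "S x = y" "G0 x = s * G1 x" by (auto simp: extension_iff)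
    then show "cinner y u = cinner x v" using green[of x u] u by simp
  qed
qed

lemma self_adjoint_extension_0: "self_adjoint_op (extension 0)"
  using linear_op_extension[of 0] dense_extension[of 0] adj_extension[of 0] by (simp add: self_adjoint_op_def)

text \<open>Green's formula with both arguments equal to \<open>f\<close>. For
  \<open>s = - \<i>\<close> the value is nonnegative, which is the dissipativity of the main
  operator.\<close>

lemma Im_cinner_extension:
  assumes "(f, y) \<in> extension s"
  shows "Im (cinner y f) = - Im s * (cmod (G1 f))\<^sup>2"
proof -
  have f: "f \<in> D" "S f = y" "G0 f = s * G1 f" using assms by (auto simp: extension_iff)
  have "cinner y f - cnj (cinner y f) = G1 f * cnj (G1 f) * (cnj s - s)"
    using green[OF f(1) f(1)] f cinner_commute[of f y] by (simp add: algebra_simps)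
  also have "\<dots> = complex_of_real ((cmod (G1 f))\<^sup>2) * (cnj s - s)"
    by (simp only: complex_mult_cnj cmod_power2)
  finally have eq: "cinner y f - cnj (cinner y f) = complex_of_real ((cmod (G1 f))\<^sup>2) * (cnj s - s)" .
  have "Im (a - cnj a) = 2 * Im a" "Im (complex_of_real r * (cnj a - a)) = - 2 * r * Im a" for a r
    by simp_all
  from this(1)[of "cinner y f"] this(2)[of "(cmod (G1 f))\<^sup>2" s] show ?thesis
    unfolding eq by (simp only: mult_minus_left mult.assoc mult.commute[of "Im s"])
qed

text \<open>Start from any \<open>q\<close> with \<open>G0 q = 1\<close> and remove the failure of
  the eigenvalue equation by solving in the self-adjoint \<open>extension 0\<close>, on which
  \<open>G0\<close> vanishes. The value of \<open>G1\<close> at the result is the Weyl function at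
  \<open>z\<close>.\<close>

lemma defect_vector:
  assumes z: "Im z \<noteq> 0"
  obtains f where "(f, z *\<^sub>C f) \<in> adj A" "G0 f = 1"
proof -
  obtain q where q: "q \<in> D" "G0 q = 1" using surj0 by blast
  obtain h y where h: "(h, y) \<in> extension 0" "y - z *\<^sub>C h = S q - z *\<^sub>C q"
    using self_adjoint_shift_surj[OF self_adjoint_extension_0 z] .
  then have hD: "h \<in> D" "S h = y" "G0 h = 0" by (auto simp: extension_iff)
  have "S (q - h) = z *\<^sub>C (q - h)"
    using h(2) hD q by (simp add: S_diff complex_vector.scale_right_diff_distrib algebra_simps)
  then show thesis using that[of "q - h"] q hD by (auto simp: adj_iff G0_diff)
qed

text \<open>Dissipativity gives injectivity and the bound at \<open>- \<i>\<close>. For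
  surjectivity, solve the equation in \<open>extension 0\<close> and correct the boundary condition
  by a multiple of the defect vector at \<open>- \<i>\<close>.\<close>

lemma resolvent_extension: "- \<i> \<in> resolvent_set (extension (- \<i>))"
proof -
  have bound: "norm f \<le> 1 * norm (y - (- \<i>) *\<^sub>C f)" if "(f, y) \<in> extension (- \<i>)" for f y
    using dissipative_lower_bound[of y f "- \<i>"] Im_cinner_extension[OF that] by simp
  have inj: "f = f'" if "(f, y) \<in> extension (- \<i>)" "(f', y') \<in> extension (- \<i>)"
    "y - (- \<i>) *\<^sub>C f = y' - (- \<i>) *\<^sub>C f'" for f y f' y'
  proof -
    have "norm (f - f') \<le> 1 * norm ((y - y') - (- \<i>) *\<^sub>C (f - f'))"
      by (intro bound linear_op_diff linear_op_extension that)
    also have "(y - y') - (- \<i>) *\<^sub>C (f - f') = 0"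
      using that(3) by (simp add: complex_vector.scale_right_diff_distrib algebra_simps)
    finally show ?thesis by simp
  qed
  have "\<exists>f y. (f, y) \<in> extension (- \<i>) \<and> y - (- \<i>) *\<^sub>C f = h" for h
  proof -
    obtain a b where ab: "(a, b) \<in> extension 0" "b - (- \<i>) *\<^sub>C a = h"
      using self_adjoint_shift_surj[OF self_adjoint_extension_0, of "- \<i>"] by auto
    then have a: "a \<in> D" "S a = b" "G0 a = 0" by (auto simp: extension_iff)
    obtain e where e: "(e, (- \<i>) *\<^sub>C e) \<in> adj A" "G0 e = 1"
      using defect_vector[of "- \<i>"] by auto
    then have eD: "e \<in> D" "S e = (- \<i>) *\<^sub>C e" by (auto simp: adj_iff)
    \<comment> \<open>If this denominator vanished, the defect vector \<open>e\<close> would be an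
      eigenvector of the dissipative extension at \<open>- \<i>\<close>, against the lower
      bound.\<close>
    have ne: "1 + \<i> * G1 e \<noteq> 0"
    proof
      assume "1 + \<i> * G1 e = 0"
      then have "G0 e = - \<i> * G1 e" using e(2) by (simp add: add_eq_0_iff)
      then have "(e, (- \<i>) *\<^sub>C e) \<in> extension (- \<i>)" using eD by (simp add: extension_iff)
      from bound[OF this] have "e = 0" by simp
      then show False using e(2) G0_zero by simp
    qed
    \<comment> \<open>Since \<open>G0 a = 0\<close> and \<open>G0 e = 1\<close>, the boundary
      condition for \<open>a + c e\<close> reads \<open>c = - \<i> * (G1 a + c * G1 e)\<close>; this
      is its solution.\<close>
    define c where "c = - \<i> * G1 a / (1 + \<i> * G1 e)"
    have "c * (1 + \<i> * G1 e) = - \<i> * G1 a" using ne by (simp add: c_def)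
    then have "(a + c *\<^sub>C e, S (a + c *\<^sub>C e)) \<in> extension (- \<i>)"
      using a eD e(2) by (auto simp: extension_iff G0_add G1_add G0_scale G1_scale algebra_simps)
    moreover have "S (a + c *\<^sub>C e) - (- \<i>) *\<^sub>C (a + c *\<^sub>C e) = h"
      using ab(2) a eD
      by (simp add: S_add S_scale scaleC_add_right scaleC_scaleC mult.commute)
    ultimately show ?thesis by blast
  qed
  then have "\<exists>!f. \<exists>y. (f, y) \<in> extension (- \<i>) \<and> y - (- \<i>) *\<^sub>C f = h" for h
    using inj by (metis (no_types, lifting))
  moreover have "\<exists>C. \<forall>(f, y)\<in>extension (- \<i>). norm f \<le> C * norm (y - (- \<i>) *\<^sub>C f)"
    using bound by blast
  ultimately show ?thesis unfolding resolvent_set_def by blast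
qed

text \<open>The boundary lines for \<open>- \<i>\<close> and \<open>\<i>\<close> differ and meet
  only at zero. The former excludes symmetry, the latter makes the domains of the operator and its
  adjoint intersect in that of \<open>A\<close>.\<close>

lemma main_operator_extension: "main_operator A (extension (- \<i>))"
proof -
  have ext_adj: "adj (extension (- \<i>)) = extension \<i>" using adj_extension[of "- \<i>"] by simp
  have "\<not> symmetric_op (extension (- \<i>))"
  proof
    assume "symmetric_op (extension (- \<i>))"
    then have "extension (- \<i>) \<subseteq> extension \<i>" by (simp add: symmetric_op_def ext_adj)
    moreover obtain f where f: "f \<in> D" "G0 f = - \<i>" "G1 f = 1" using extension_witness .
    then have "(f, S f) \<in> extension (- \<i>)" by (simp add: extension_iff)
    ultimately have "G0 f = \<i> * G1 f" using extension_iff by blast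
    then show False using f by (simp add: complex_eq_iff)
  qed
  moreover have "Domain A = Domain (extension (- \<i>)) \<inter> Domain (adj (extension (- \<i>)))"
  proof -
    have "Domain A = {f \<in> D. G0 f = 0 \<and> G1 f = 0}"
      using boundary_zero_iff by (auto simp: adj_iff Domain_iff)
    also have "\<dots> = {f \<in> D. G0 f = - \<i> * G1 f \<and> G0 f = \<i> * G1 f}" by auto
    finally show ?thesis unfolding ext_adj Domain_extension by blast
  qed
  ultimately show ?thesis
    using linear_op_extension[of "- \<i>"] A_sub_extension[of "- \<i>"] extension_sub_adj[of "- \<i>"] resolvent_extension
    unfolding main_operator_def by blast
qed

section \<open>From a boundary triple to an L-system and its impedance function\<close>

definition chi :: "'h \<Rightarrow> complex" where
  "chi u = (if u \<in> D then cnj (G1 u) else 0)"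

definition real_part :: "'h \<Rightarrow> 'h \<Rightarrow> complex" where
  "real_part f u = embed A (S f) u + G0 f * chi u"

text \<open>The functional \<open>chi\<close> vanishes on the dense domain of \<open>A\<close>
  without being zero, so it does not belong to the embedded Hilbert space.\<close>

lemma embed_chi_eq_0:
  assumes "\<And>u. embed A h u + c * chi u = 0"
  shows "h = 0 \<and> c = 0"
proof -
  have "cinner h u = 0" if "u \<in> Domain A" for u
  proof -
    obtain v where "(u, v) \<in> A" using \<open>u \<in> Domain A\<close> by blast
    then have "u \<in> D" "G1 u = 0" using boundary_zero_iff by (auto simp: adj_iff)
    then show ?thesis using assms[of u] by (simp add: embed_def chi_def)
  qed
  then have "h = 0" using orthogonal_dense_eq_0[OF dense] by blast
  moreover obtain p where "p \<in> D" "G1 p = 1" using surj1 by blast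
  ultimately show ?thesis using assms[of p] by (simp add: embed_def chi_def)
qed

lemma real_part_shift_inj:
  assumes z: "Im z \<noteq> 0" and f: "f \<in> D" and g: "g \<in> D"
    and eq: "\<And>u. real_part f u - z * embed A f u = real_part g u - z * embed A g u"
  shows "f = g"
proof -
  have "embed A (S (f - g) - z *\<^sub>C (f - g)) u + G0 (f - g) * chi u = 0" for u
    using eq[of u] f g
    by (simp add: real_part_def embed_def S_diff G0_diff cinner_diff_left cinner_add_left cinner_scaleC_left
        algebra_simps split: if_splits)
  then have "S (f - g) - z *\<^sub>C (f - g) = 0 \<and> G0 (f - g) = 0" by (rule embed_chi_eq_0)
  then have "(f - g, z *\<^sub>C (f - g)) \<in> extension 0" using f g by (simp add: extension_iff)
  then show ?thesis using self_adjoint_shift_inj[OF self_adjoint_extension_0 z, of "f - g"] by simp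
qed

text \<open>Because \<open>chi\<close> lies outside the Hilbert space, \<open>real_part f\<close>
  lies inside exactly when its coefficient \<open>G0 f\<close> vanishes.\<close>

lemma quasi_kernel_eq:
  assumes "\<And>f. f \<in> D \<Longrightarrow> R f = real_part f"
  shows "quasi_kernel A R = extension 0"
proof (intro set_eqI, clarify, intro iffI)
  fix f h assume "(f, h) \<in> quasi_kernel A R"
  then have f: "f \<in> D" "real_part f = embed A h" using assms by (auto simp: quasi_kernel_def)
  have "embed A (S f - h) u + G0 f * chi u = 0" for u
    using fun_cong[OF f(2), of u]
    by (simp add: real_part_def embed_def cinner_diff_left algebra_simps split: if_splits)
  then have "S f - h = 0 \<and> G0 f = 0" by (rule embed_chi_eq_0)
  then show "(f, h) \<in> extension 0" using f(1) by (simp add: extension_iff)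
next
  fix f h assume "(f, h) \<in> extension 0"
  then show "(f, h) \<in> quasi_kernel A R"
    using assms[of f] by (auto simp: extension_iff quasi_kernel_def real_part_def)
qed

text \<open>On the defect vector \<open>f\<close> the term \<open>S f - z f\<close> cancels, so the
  shifted real part sends \<open>f\<close> to \<open>chi\<close>, which is \<open>K 1\<close>.
  Injectivity identifies \<open>f\<close> as the value of \<open>inv_into\<close>, and the adjoint
  channel reads off \<open>G1 f\<close>.\<close>

lemma impedance_eq:
  assumes A: "sym_op \<Theta> = A"
    and R: "\<And>f. f \<in> D \<Longrightarrow> rig_Re A (state_op \<Theta>) f = real_part f"
    and K: "channel_op \<Theta> 1 = chi"
    and z: "Im z \<noteq> 0" and f: "(f, z *\<^sub>C f) \<in> adj A" "G0 f = 1"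
  shows "impedance \<Theta> z = G1 f"
proof -
  let ?L = "\<lambda>f u. rig_Re A (state_op \<Theta>) f u - z * embed A f u"
  have fD: "f \<in> D" "S f = z *\<^sub>C f" using f by (auto simp: adj_iff)
  have "inj_on ?L D"
  proof (rule inj_onI)
    fix g h assume "g \<in> D" "h \<in> D" "?L g = ?L h"
    then show "g = h" using real_part_shift_inj[OF z, of g h] R by (metis (no_types, lifting))
  qed
  then have "inv_into D ?L (?L f) = f" using fD(1) by (rule inv_into_f_f)
  moreover have "?L f = chi"
    using fD f(2) by (auto simp: R real_part_def embed_def cinner_scaleC_left)
  ultimately have "inv_into D ?L chi = f" by (simp only:)
  then show ?thesis
    using fD by (simp add: impedance_def Let_def A K channel_adj_def chi_def)
qed

text \<open>The state operator is \<open>real_part\<close> plus \<open>\<i>\<close> times the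
  channel composed with its adjoint. The coefficient of \<open>chi\<close> vanishes precisely on the
  domain of the main operator.\<close>

definition system :: "'h l_system" where
  "system = \<lparr>sym_op = A, main_op = extension (- \<i>),
     state_op = \<lambda>f u. embed A (S f) u + (G0 f + \<i> * G1 f) * chi u,
     channel_op = \<lambda>c u. c * chi u\<rparr>"

text \<open>Green's formula says that \<open>real_part\<close> is Hermitian, and
  \<open>G1 f * chi u\<close> is visibly Hermitian; hence these are the real and imaginary
  parts.\<close>

lemma system_Re_Im:
  assumes "f \<in> D"
  shows "rig_Re A (state_op system) f = real_part f"
    and "rig_Im A (state_op system) f = (\<lambda>u. G1 f * chi u)"
proof -
  let ?B = "state_op system"
  have B: "?B f u = real_part f u + \<i> * G1 f * chi u" for u
    by (simp add: system_def real_part_def algebra_simps)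
  have B': "rig_adj A ?B f u = real_part f u - \<i> * G1 f * chi u" for u
  proof (cases "u \<in> D")
    case True
    have "cnj (cinner (S u) f) = cinner f (S u)" by (metis cinner_commute)
    then show ?thesis
      using green[OF assms True] True assms
      by (simp add: rig_adj_def system_def real_part_def embed_def chi_def algebra_simps)
  qed (simp add: rig_adj_def real_part_def embed_def chi_def)
  show "rig_Re A ?B f = real_part f" "rig_Im A ?B f = (\<lambda>u. G1 f * chi u)"
    by (auto simp: rig_Re_def rig_Im_def B B')
qed

text \<open>All values of the state and channel operators have the form
  \<open>embed A h + c chi\<close>, so a single estimate with a uniform constant bounds both
  operators.\<close>

lemma embed_chi_bound:
  "\<exists>C\<ge>0. \<forall>h c. \<forall>u\<in>D. cmod (embed A h u + c * chi u) \<le> (2 * norm h + C * cmod c) * plus_norm A u"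
proof -
  obtain C where C: "0 \<le> C" "\<And>f. f \<in> D \<Longrightarrow> cmod (G1 f) \<le> C * plus_norm A f"
    using G1_bounded bounded_functional_nonneg by metis
  have bound: "cmod (embed A h u + c * chi u) \<le> (2 * norm h + C * cmod c) * plus_norm A u"
    if "u \<in> D" for h c u
  proof -
    have "cmod (embed A h u + c * chi u) \<le> cmod (cinner h u) + cmod c * cmod (G1 u)"
      using norm_triangle_ineq[of "cinner h u" "c * cnj (G1 u)"] that
      by (simp add: embed_def chi_def norm_mult)
    also have "\<dots> \<le> 2 * (norm h * norm u) + cmod c * (C * plus_norm A u)"
      using that by (intro add_mono norm_cinner_le mult_left_mono C) auto
    also have "\<dots> \<le> 2 * (norm h * plus_norm A u) + cmod c * (C * plus_norm A u)"
      by (intro add_mono mult_left_mono norm_le_plus_norm order_refl) auto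
    finally show ?thesis by (simp add: algebra_simps)
  qed
  then show ?thesis using C(1) by blast
qed

lemma embed_chi_minus_space: "(\<lambda>u. embed A h u + c * chi u) \<in> minus_space A"
  unfolding minus_space_def
proof (intro CollectI conjI)
  show "\<exists>C. \<forall>u\<in>D. cmod (embed A h u + c * chi u) \<le> C * plus_norm A u"
    using embed_chi_bound by blast
qed (auto simp: embed_def chi_def G1_add G1_scale cinner_add_right cinner_scaleC_right algebra_simps)

lemma bounded_state: "bounded_plus_minus A (state_op system)"
proof -
  obtain C where C: "0 \<le> C"
    and bound: "\<And>h c u. u \<in> D \<Longrightarrow> cmod (embed A h u + c * chi u) \<le> (2 * norm h + C * cmod c) * plus_norm A u"
    using embed_chi_bound by blast
  obtain C0 where C0: "0 \<le> C0" "\<And>f. f \<in> D \<Longrightarrow> cmod (G0 f) \<le> C0 * plus_norm A f"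
    using G0_bounded bounded_functional_nonneg by metis
  obtain C1 where C1: "0 \<le> C1" "\<And>f. f \<in> D \<Longrightarrow> cmod (G1 f) \<le> C1 * plus_norm A f"
    using G1_bounded bounded_functional_nonneg by metis
  have "minus_norm A (state_op system f) \<le> (2 + C * (C0 + C1)) * plus_norm A f" if f: "f \<in> D" for f
  proof -
    have "minus_norm A (state_op system f) \<le> 2 * norm (S f) + C * cmod (G0 f + \<i> * G1 f)"
      unfolding system_def l_system.simps using C by (intro minus_norm_le bound) auto
    also have "\<dots> \<le> 2 * plus_norm A f + C * (C0 * plus_norm A f + C1 * plus_norm A f)"
      using f norm_triangle_ineq[of "G0 f" "\<i> * G1 f"] C0(2)[OF f] C1(2)[OF f]
      by (intro add_mono mult_left_mono norm_le_plus_norm C) (auto simp: norm_mult)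
    finally show ?thesis by (simp add: algebra_simps)
  qed
  then have "\<exists>C. \<forall>f\<in>D. minus_norm A (state_op system f) \<le> C * plus_norm A f" by blast
  moreover have "\<forall>f\<in>D. state_op system f \<in> minus_space A"
    by (simp add: system_def embed_chi_minus_space)
  ultimately show ?thesis
    unfolding bounded_plus_minus_def
    by (auto simp: system_def S_add S_scale G0_add G1_add G0_scale G1_scale embed_def
        cinner_add_left cinner_scaleC_left algebra_simps fun_eq_iff)
qed

lemma bounded_channel: "bounded_complex_minus A (channel_op system)"
proof -
  obtain C where C: "0 \<le> C"
    and bound: "\<And>h c u. u \<in> D \<Longrightarrow> cmod (embed A h u + c * chi u) \<le> (2 * norm h + C * cmod c) * plus_norm A u"
    using embed_chi_bound by blast
  have embed0: "embed A 0 u = 0" for u by (simp add: embed_def)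
  have "minus_norm A (\<lambda>u. c * chi u) \<le> C * cmod c" for c
    using bound[of _ 0 c] C by (intro minus_norm_le) (auto simp: embed0)
  then show ?thesis
    using embed_chi_minus_space[of 0] unfolding bounded_complex_minus_def
    by (auto simp: system_def embed0 algebra_simps fun_eq_iff)
qed

theorem is_l_system_system:
  assumes "deficiency_indices A = (1, 1)"
  shows "is_l_system system"
proof -
  have ext_adj: "adj (extension (- \<i>)) = extension \<i>" using adj_extension[of "- \<i>"] by simp
  have 1: "extends_op A (extension (- \<i>)) (state_op system)"
    by (auto simp: extends_op_def extension_iff system_def)
  \<comment> \<open>The adjoint is the real part minus \<open>\<i>\<close> times the imaginary part,
    so \<open>chi\<close> has coefficient \<open>G0 f - \<i> * G1 f\<close>, which is zero on
    \<open>extension \<i>\<close>.\<close>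
  have "rig_adj A (state_op system) f = embed A (S f)" if "f \<in> D" "G0 f = \<i> * G1 f" for f
  proof
    fix u
    have "rig_adj A (state_op system) f u
        = rig_Re A (state_op system) f u - \<i> * rig_Im A (state_op system) f u"
      by (simp add: rig_Re_def rig_Im_def field_simps)
    then show "rig_adj A (state_op system) f u = embed A (S f) u"
      using that by (simp add: system_Re_Im real_part_def)
  qed
  then have 2: "extends_op A (extension \<i>) (rig_adj A (state_op system))"
    by (auto simp: extends_op_def extension_iff)
  have 3: "quasi_kernel A (rig_Re A (state_op system)) = extension 0"
    by (rule quasi_kernel_eq) (rule system_Re_Im)
  have 4: "channel_adj (channel_op system) f = G1 f" if "f \<in> D" for f
    using that by (simp add: channel_adj_def system_def chi_def)
  have 5: "range (channel_op system) = rig_Im A (state_op system) ` D"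
  proof -
    \<comment> \<open>Equality of the two ranges amounts to surjectivity of
      \<open>G1\<close>.\<close>
    have "G1 ` D = UNIV"
    proof (rule sym, rule UNIV_eq_I)
      fix c
      obtain p where "p \<in> D" "G1 p = 1" using surj1 by blast
      then have "c *\<^sub>C p \<in> D" "c = G1 (c *\<^sub>C p)" by (auto simp: G1_scale)
      then show "c \<in> G1 ` D" by blast
    qed
    then have "range (channel_op system) = (\<lambda>f u. G1 f * chi u) ` D"
      unfolding system_def l_system.simps image_image[of "\<lambda>c u. c * chi u" G1 D, symmetric] by simp
    then show ?thesis using system_Re_Im(2) by auto
  qed
  have [simp]: "sym_op system = A" "main_op system = extension (- \<i>)" by (simp_all add: system_def)
  have "channel_op system c = (\<lambda>u. c * chi u)" for c by (simp add: system_def)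
  then show ?thesis
    unfolding is_l_system_def Let_def star_extension_def
    using symmetric closed assms main_operator_extension bounded_state bounded_channel A_sub_extension
      1 2 3 4 5 self_adjoint_extension_0 system_Re_Im(2)
    by (simp add: ext_adj)
qed

text \<open>The new terms in Green's formula are \<open>q * G0 f * cnj (G0 g)\<close> with opposite
  signs; they cancel because \<open>q\<close> is real.\<close>

lemma boundary_triple_shift:
  "boundary_triple A G0 (\<lambda>f. G1 f + complex_of_real q * G0 f)"
proof unfold_locales
  obtain p r where pr: "p \<in> D" "G0 p = 0" "G1 p = 1" "r \<in> D" "G0 r = 1" "G1 r = 0"
    using surj0 surj1 by blast
  then show "\<exists>f\<in>D. G0 f = 0 \<and> G1 f + complex_of_real q * G0 f = 1" by force
  \<comment> \<open>This vector has boundary values \<open>(1, - q)\<close> in the old triple, hence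
    \<open>(1, 0)\<close> in the new one.\<close>
  from pr have "r - complex_of_real q *\<^sub>C p \<in> D"
    "G0 (r - complex_of_real q *\<^sub>C p) = 1" "G1 (r - complex_of_real q *\<^sub>C p) = - complex_of_real q"
    by (simp_all add: G0_diff G1_diff G0_scale G1_scale)
  then show "\<exists>f\<in>D. G0 f = 1 \<and> G1 f + complex_of_real q * G0 f = 0" by force
  obtain C0 where C0: "\<And>f. f \<in> D \<Longrightarrow> cmod (G0 f) \<le> C0 * plus_norm A f"
    using G0_bounded by blast
  obtain C1 where C1: "\<And>f. f \<in> D \<Longrightarrow> cmod (G1 f) \<le> C1 * plus_norm A f"
    using G1_bounded by blast
  have "cmod (G1 f + complex_of_real q * G0 f) \<le> (C1 + \<bar>q\<bar> * C0) * plus_norm A f" if "f \<in> D" for f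
  proof -
    have "cmod (G1 f + complex_of_real q * G0 f) \<le> cmod (G1 f) + \<bar>q\<bar> * cmod (G0 f)"
      using norm_triangle_ineq[of "G1 f" "complex_of_real q * G0 f"] by (simp add: norm_mult)
    also have "\<dots> \<le> C1 * plus_norm A f + \<bar>q\<bar> * (C0 * plus_norm A f)"
      by (intro add_mono mult_left_mono C0 C1 that) simp
    finally show ?thesis by (simp add: algebra_simps)
  qed
  then show "\<exists>C. \<forall>f\<in>D. cmod (G1 f + complex_of_real q * G0 f) \<le> C * plus_norm A f" by blast
qed (simp_all add: closed G0_add G0_scale G1_add G1_scale green algebra_simps)

end


section \<open>The boundary triple of an L-system\<close>

text \<open>Deficiency index one makes the domain of the quasi-kernel a hyperplane in the positive
  space. The real part agrees with \<open>adj A\<close> on it, so the two differ by a rank-one term,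
  whose functional the main operator shows to be a multiple of \<open>K 1\<close>.\<close>

lemma l_system_boundary_triple:
  fixes \<Theta> :: "'h::chilbert_space l_system"
  assumes \<Theta>: "is_l_system \<Theta>"
  obtains G0 where "boundary_triple (sym_op \<Theta>) G0 (channel_adj (channel_op \<Theta>))"
    and "\<And>f. f \<in> plus_space (sym_op \<Theta>) \<Longrightarrow> rig_Re (sym_op \<Theta>) (state_op \<Theta>) f
      = boundary_triple.real_part (sym_op \<Theta>) G0 (channel_adj (channel_op \<Theta>)) f"
    and "channel_op \<Theta> 1 = boundary_triple.chi (sym_op \<Theta>) (channel_adj (channel_op \<Theta>))"
proof -
  define A T B K where "A = sym_op \<Theta>" and "T = main_op \<Theta>" and "B = state_op \<Theta>"
    and "K = channel_op \<Theta>"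
  define G1 where "G1 = channel_adj K"
  define R where "R = rig_Re A B"
  define H where "H = quasi_kernel A R"
  have A: "symmetric_op A" "closed A" "deficiency_indices A = (1, 1)"
    and T: "linear_op T" "\<not> symmetric_op T" "A \<subseteq> T" "T \<subseteq> adj A"
    and B: "bounded_plus_minus A B" and TB: "extends_op A T B"
    and AT: "A \<subseteq> adj T" and TB': "extends_op A (adj T) (rig_adj A B)"
    and H: "self_adjoint_op H" and K: "bounded_complex_minus A K"
    and Im: "\<And>f. f \<in> plus_space A \<Longrightarrow> rig_Im A B f = K (G1 f)"
    using \<Theta> unfolding is_l_system_def Let_def star_extension_def main_operator_def
      A_def T_def B_def K_def R_def H_def G1_def by blast+
  interpret dense_symmetric A by unfold_locales (rule A)

  have K_ms: "K 1 \<in> minus_space A" and K_scale: "K c u = c * K 1 u" for c u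
  proof -
    show "K 1 \<in> minus_space A" using K by (simp add: bounded_complex_minus_def)
    have "K (c * 1) = (\<lambda>u. c * K 1 u)" using K unfolding bounded_complex_minus_def by blast
    then show "K c u = c * K 1 u" by simp
  qed
  have K_cnj: "K 1 u = cnj (G1 u)" for u by (simp add: G1_def channel_adj_def)
  have K_out: "K 1 u = 0" if "u \<notin> D" for u using K_ms that by (simp add: minus_space_def)
  have G1_add: "G1 (f + g) = G1 f + G1 g" if "f \<in> D" "g \<in> D" for f g
    using K_ms that by (simp add: minus_space_def G1_def channel_adj_def)
  have G1_scale: "G1 (c *\<^sub>C f) = c * G1 f" if "f \<in> D" for c f
    using K_ms that by (simp add: minus_space_def G1_def channel_adj_def)
  have G1_bdd: "\<exists>C. \<forall>f\<in>D. cmod (G1 f) \<le> C * plus_norm A f"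
    using K_ms by (simp add: minus_space_def G1_def channel_adj_def)

  have B_ms: "B f \<in> minus_space A" if "f \<in> D" for f
    using B that by (simp add: bounded_plus_minus_def)
  have B_lin: "B f (u + v) = B f u + B f v" "B f (c *\<^sub>C u) = cnj c * B f u"
    "B (u + v) f = B u f + B v f" "B (c *\<^sub>C u) f = c * B u f"
    if "f \<in> D" "u \<in> D" "v \<in> D" for f u v c
    using B_ms[OF that(1)] B that by (simp_all add: minus_space_def bounded_plus_minus_def)
  have R_eq: "R f u = (B f u + cnj (B u f)) / 2" if "u \<in> D" for f u
    using that by (simp add: R_def rig_Re_def rig_adj_def)
  have R_out: "R f u = 0" if "f \<in> D" "u \<notin> D" for f u
    using B_ms[OF that(1)] that(2) by (simp add: R_def rig_Re_def rig_adj_def minus_space_def)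
  have R_herm: "R f u = cnj (R u f)" if "f \<in> D" "u \<in> D" for f u
    using that by (simp add: R_eq)
  have R_add: "R (f + g) u = R f u + R g u" if "f \<in> D" "g \<in> D" "u \<in> D" for f g u
    using that by (simp add: R_eq B_lin field_simps)
  have R_scale: "R (c *\<^sub>C f) u = c * R f u" if "f \<in> D" "u \<in> D" for c f u
    using that by (simp add: R_eq B_lin field_simps)
  have B_R: "B f u = R f u + \<i> * (G1 f * K 1 u)" if "f \<in> D" for f u
  proof -
    have "B f u = R f u + \<i> * rig_Im A B f u"
      by (simp add: R_def rig_Re_def rig_Im_def field_simps)
    then show ?thesis by (simp add: Im[OF that] K_scale[of "G1 f" u])
  qed

  have H_iff: "(f, h) \<in> H \<longleftrightarrow> f \<in> D \<and> R f = embed A h" for f h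
    by (simp add: H_def quasi_kernel_def)
  have A_B: "R f = embed A y \<and> G1 f = 0" if fy: "(f, y) \<in> A" for f y
  proof -
    have *: "B f = embed A y" "rig_adj A B f = embed A y"
      using fy T(3) AT TB TB' by (auto simp: extends_op_def)
    have f: "f \<in> D" using fy D_A by blast
    \<comment> \<open>The state operator and its adjoint both extend \<open>A\<close>, so the
      imaginary part vanishes at \<open>f\<close>; paired with \<open>f\<close> it equals the
      squared modulus of \<open>G1 f\<close>.\<close>
    have "rig_Im A B f f = 0" by (simp add: rig_Im_def *)
    then have "G1 f * cnj (G1 f) = 0" by (simp add: Im[OF f] K_scale[of "G1 f"] K_cnj)
    then show ?thesis by (auto simp: R_def rig_Re_def *)
  qed
  have A_H: "A \<subseteq> H"
    using A_B D_A by (auto simp: H_iff)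
  have adj_H: "adj H = H" using H by (simp add: self_adjoint_op_def)
  have lin_H: "linear_op H" using H by (simp add: self_adjoint_op_def)
  have H_adj: "H \<subseteq> adj A" using adj_antimono[OF A_H] adj_H by simp
  define DH where "DH = Domain H"
  have DH_D: "f \<in> D" if "f \<in> DH" for f
    using that H_adj by (auto simp: DH_def plus_space_def)
  have DH_S: "(f, S f) \<in> H" if "f \<in> DH" for f
    using that H_adj by (auto simp: DH_def adj_iff)
  have DH_R: "R f u = cinner (S f) u" if "f \<in> DH" "u \<in> D" for f u
    using DH_S[OF that(1)] that(2) by (auto simp: H_iff embed_def)
  have DH_sub: "complex_vector.subspace DH"
    unfolding complex_vector.subspace_def DH_def
    using linear_op_zero[OF lin_H] linear_op_add[OF lin_H] linear_op_scaleC[OF lin_H] by blast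

  obtain g where g: "g \<noteq> 0" "(g, \<i> *\<^sub>C g) \<in> adj A"
    and line: "\<And>f. (f, \<i> *\<^sub>C f) \<in> adj A \<Longrightarrow> \<exists>c. f = c *\<^sub>C g"
    using deficiency_line[OF A(3)] by blast
  have gD: "g \<in> D" "S g = \<i> *\<^sub>C g" using g(2) by (auto simp: adj_iff)
  have g_DH: "g \<notin> DH"
  proof
    assume "g \<in> DH"
    then have "(g, \<i> *\<^sub>C g) \<in> H" using DH_S gD by fastforce
    then show False using self_adjoint_shift_inj[OF H, of \<i> g] g(1) by simp
  qed

  \<comment> \<open>The positive space is \<open>DH\<close> plus the line of \<open>g\<close>: solve
    in \<open>H\<close> for the image of \<open>f\<close> under \<open>S - \<i>\<close>; the
    difference of \<open>f\<close> and the solution is a deficiency vector at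
    \<open>\<i>\<close>.\<close>
  have ex_coord: "\<exists>c. f - c *\<^sub>C g \<in> DH" if f: "f \<in> D" for f
  proof -
    obtain a b where ab: "(a, b) \<in> H" "b - \<i> *\<^sub>C a = S f - \<i> *\<^sub>C f"
      using self_adjoint_shift_surj[OF H, of \<i> "S f - \<i> *\<^sub>C f"] by auto
    then have a: "a \<in> DH" "a \<in> D" "S a = b" using DH_D H_adj by (auto simp: DH_def adj_iff)
    have "S (f - a) = \<i> *\<^sub>C (f - a)"
      using ab(2) a f by (simp add: S_diff complex_vector.scale_right_diff_distrib algebra_simps)
    then obtain c where "f - a = c *\<^sub>C g" using line f a by (auto simp: adj_iff)
    then have "f - c *\<^sub>C g = a" by (simp add: algebra_simps)
    then show ?thesis using a(1) by auto
  qed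
  \<comment> \<open>The coordinate along \<open>g\<close> modulo \<open>DH\<close>. It is unique
    because \<open>g\<close> lies outside \<open>DH\<close>, and linearity follows from
    uniqueness.\<close>
  define C where "C f = (SOME c. f - c *\<^sub>C g \<in> DH)" for f
  have C: "f - C f *\<^sub>C g \<in> DH" if "f \<in> D" for f
    unfolding C_def using ex_coord[OF that] by (rule someI_ex)
  have C_eqI: "C f = c" if "f \<in> D" "f - c *\<^sub>C g \<in> DH" for f c
  proof (rule ccontr)
    assume "C f \<noteq> c"
    have "(f - C f *\<^sub>C g) - (f - c *\<^sub>C g) \<in> DH"
      using complex_vector.subspace_diff[OF DH_sub C[OF that(1)] that(2)] .
    also have "(f - C f *\<^sub>C g) - (f - c *\<^sub>C g) = (c - C f) *\<^sub>C g"
      by (simp add: complex_vector.scale_left_diff_distrib)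
    finally have "inverse (c - C f) *\<^sub>C (c - C f) *\<^sub>C g \<in> DH"
      by (rule complex_vector.subspace_scale[OF DH_sub])
    then show False using g_DH \<open>C f \<noteq> c\<close> by simp
  qed
  have C_add: "C (f + h) = C f + C h" if "f \<in> D" "h \<in> D" for f h
  proof (rule C_eqI)
    have "(f + h) - (C f + C h) *\<^sub>C g = (f - C f *\<^sub>C g) + (h - C h *\<^sub>C g)"
      by (simp add: scaleC_add_left)
    then show "(f + h) - (C f + C h) *\<^sub>C g \<in> DH"
      using complex_vector.subspace_add[OF DH_sub C C] that by metis
  qed (use that in auto)
  have C_scale: "C (c *\<^sub>C f) = c * C f" if "f \<in> D" for c f
  proof (rule C_eqI)
    have "c *\<^sub>C f - (c * C f) *\<^sub>C g = c *\<^sub>C (f - C f *\<^sub>C g)"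
      by (simp add: complex_vector.scale_right_diff_distrib)
    then show "c *\<^sub>C f - (c * C f) *\<^sub>C g \<in> DH"
      using complex_vector.subspace_scale[OF DH_sub C] that by metis
  qed (use that in auto)
  have C_0: "C f = 0 \<longleftrightarrow> f \<in> DH" if "f \<in> D" for f
    using C[OF that] C_eqI[OF that, of 0] by auto
  have C_g: "C g = 1"
    using C_eqI[OF gD(1), of 1] complex_vector.subspace_0[OF DH_sub] by simp

  \<comment> \<open>The deviation of the real part from \<open>S\<close> at \<open>g\<close>; as
    there is none on \<open>DH\<close>, it determines the deviation everywhere.\<close>
  define w where "w u = R g u - cinner (S g) u" for u
  have R_w: "R f u = cinner (S f) u + C f * w u" if f: "f \<in> D" and u: "u \<in> D" for f u
  proof -
    define a where "a = f - C f *\<^sub>C g"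
    have a: "a \<in> DH" "a \<in> D" using C[OF f] DH_D by (auto simp: a_def)
    have fa: "f = a + C f *\<^sub>C g" by (simp add: a_def)
    have Rf: "R f u = R a u + C f * R g u"
      using R_add[of a "C f *\<^sub>C g" u] R_scale[of g u "C f"] a(2) gD(1) u fa by simp
    have Sf: "S f = S a + C f *\<^sub>C S g"
      using S_add[of a "C f *\<^sub>C g"] S_scale[of g "C f"] a(2) gD(1) fa by simp
    show ?thesis
      unfolding Rf Sf by (simp add: DH_R[OF a(1) u] w_def cinner_add_left cinner_scaleC_left algebra_simps)
  qed

  \<comment> \<open>If every \<open>f\<close> in the domain of \<open>T\<close> had coordinate 0,
    then \<open>T\<close> would be contained in the self-adjoint \<open>H\<close> and so be
    symmetric.\<close>
  obtain t where t: "t \<in> D" "C t \<noteq> 0" "B t = embed A (S t)"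
  proof -
    have TD: "f \<in> D \<and> y = S f \<and> B f = embed A y" if "(f, y) \<in> T" for f y
      using that T(4) TB adj_iff[of f y] by (auto simp: extends_op_def)
    have "\<exists>f y. (f, y) \<in> T \<and> C f \<noteq> 0"
    proof (rule ccontr)
      assume *: "\<nexists>f y. (f, y) \<in> T \<and> C f \<noteq> 0"
      have TH: "T \<subseteq> H"
      proof clarify
        fix f y assume fy: "(f, y) \<in> T"
        then have "f \<in> DH" using * TD C_0 by blast
        then show "(f, y) \<in> H" using DH_S TD[OF fy] by simp
      qed
      then have "T \<subseteq> adj T" using adj_antimono[OF TH] adj_H by simp
      moreover have "densely_defined T"
      proof -
        have "closure (Domain A) \<subseteq> closure (Domain T)" by (intro closure_mono Domain_mono T(3))
        then show ?thesis using dense by (auto simp: densely_defined_def)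
      qed
      ultimately show False using T(1,2) by (simp add: symmetric_op_def)
    qed
    then show thesis using that TD by blast
  qed
  \<comment> \<open>At \<open>t\<close> the state operator acts as \<open>S\<close>, so the
    deviation \<open>C t * w\<close> of the real part must cancel the imaginary contribution
    \<open>\<i> * G1 t * K 1\<close>. Dividing by \<open>C t\<close> gives this factor.\<close>
  define k where "k = - \<i> * G1 t / C t"
  have w_k: "w u = k * K 1 u" if u: "u \<in> D" for u
  proof -
    have "cinner (S t) u = R t u + \<i> * (G1 t * K 1 u)"
      using B_R[OF t(1), of u] t(3) u by (simp add: embed_def)
    then have "C t * w u = - \<i> * (G1 t * K 1 u)"
      using R_w[OF t(1) u] by (simp add: algebra_simps eq_neg_iff_add_eq_0)
    then show ?thesis using t(2) by (simp add: k_def field_simps)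
  qed
  \<comment> \<open>Otherwise the real part would map \<open>g\<close> into the Hilbert space,
    placing \<open>g\<close> in the domain of the quasi-kernel.\<close>
  have k: "k \<noteq> 0"
  proof
    assume "k = 0"
    then have "R g = embed A (S g)"
      using R_w[OF gD(1)] R_out[OF gD(1)] w_k by (auto simp: embed_def fun_eq_iff)
    then have "(g, S g) \<in> H" using gD(1) by (simp add: H_iff)
    then show False using g_DH by (auto simp: DH_def)
  qed

  define G0 where "G0 f = k * C f" for f
  have R_G0: "R f u = cinner (S f) u + G0 f * cnj (G1 u)" if "f \<in> D" "u \<in> D" for f u
    using R_w[OF that] w_k[OF that(2)] by (simp add: G0_def K_cnj)
  \<comment> \<open>Equate the formula \<open>R_G0\<close> with the conjugate of its version with
    exchanged arguments; the real part is Hermitian.\<close>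
  have green: "cinner (S f) u - cinner f (S u) = G1 f * cnj (G0 u) - G0 f * cnj (G1 u)"
    if "f \<in> D" "u \<in> D" for f u
  proof -
    have "cinner (S f) u + G0 f * cnj (G1 u) = cnj (cinner (S u) f + G0 u * cnj (G1 f))"
      using R_herm[OF that] R_G0[OF that] R_G0[OF that(2,1)] by simp
    also have "\<dots> = cinner f (S u) + cnj (G0 u) * G1 f"
      using cinner_commute[of f "S u"] by simp
    finally show ?thesis by (simp add: algebra_simps)
  qed
  \<comment> \<open>If \<open>G1\<close> vanished on \<open>DH\<close>, both boundary values would
    vanish there, so \<open>H\<close> would equal \<open>A\<close>; then \<open>A\<close> would be
    self-adjoint and \<open>g\<close> would lie in \<open>DH\<close>.\<close>
  obtain a where a: "a \<in> DH" "G1 a \<noteq> 0"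
  proof -
    have "\<exists>a\<in>DH. G1 a \<noteq> 0"
    proof (rule ccontr)
      assume *: "\<not> (\<exists>a\<in>DH. G1 a \<noteq> 0)"
      have "H \<subseteq> A"
      proof clarify
        fix f y assume fy: "(f, y) \<in> H"
        then have f: "f \<in> DH" "f \<in> D" "S f = y" using H_adj by (auto simp: DH_def adj_iff)
        then have G: "G0 f = 0" "G1 f = 0" using C_0[OF f(2)] * by (auto simp: G0_def)
        show "(f, y) \<in> A"
        proof (rule symmetric_op_kernel_eq[OF A(1,2)])
          show "(f, y) \<in> adj A" using fy H_adj by blast
          fix u v assume "(u, v) \<in> adj A"
          then show "cinner y u = cinner f v" using green[OF f(2), of u] f G by (auto simp: adj_iff)
        qed
      qed
      then have "(g, \<i> *\<^sub>C g) \<in> H" using A_H g(2) adj_H by auto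
      then show False using g_DH by (auto simp: DH_def)
    qed
    then show thesis using that by blast
  qed
  have aD: "a \<in> D" "G0 a = 0" using DH_D[OF a(1)] C_0 a(1) by (auto simp: G0_def)
  have G0_add: "G0 (f + h) = G0 f + G0 h" if "f \<in> D" "h \<in> D" for f h
    using that by (simp add: G0_def C_add algebra_simps)
  have G0_scale: "G0 (c *\<^sub>C f) = c * G0 f" if "f \<in> D" for c f
    using that by (simp add: G0_def C_scale)

  have triple: "boundary_triple A G0 G1"
  proof unfold_locales
    show "\<exists>f\<in>D. G0 f = 0 \<and> G1 f = 1"
      using a aD by (intro bexI[of _ "inverse (G1 a) *\<^sub>C a"]) (auto simp: G0_scale G1_scale)
    \<comment> \<open>Here \<open>G0 g = k\<close>, because \<open>C g = 1\<close>, and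
      \<open>G0 a = 0\<close>. The coefficient of \<open>g\<close> normalises \<open>G0\<close>, and
      that of \<open>a\<close> then cancels \<open>G1\<close>.\<close>
    let ?q = "inverse k *\<^sub>C g + (- inverse k * G1 g / G1 a) *\<^sub>C a"
    have "c *\<^sub>C g + d *\<^sub>C a \<in> D" "G0 (c *\<^sub>C g + d *\<^sub>C a) = c * k"
      "G1 (c *\<^sub>C g + d *\<^sub>C a) = c * G1 g + d * G1 a" for c d
      using aD DH_D[OF a(1)] gD(1) C_g by (simp_all add: G0_add G1_add G0_scale G1_scale G0_def[of g])
    from this(1)[of "inverse k" "- inverse k * G1 g / G1 a"] this(2)[of "inverse k" "- inverse k * G1 g / G1 a"]
      this(3)[of "inverse k" "- inverse k * G1 g / G1 a"]
    have "?q \<in> D" "G0 ?q = 1" "G1 ?q = 0"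
      using a(2) k by (simp_all only:) (simp_all add: field_simps)
    then show "\<exists>f\<in>D. G0 f = 1 \<and> G1 f = 0" by blast
  qed (use A G0_add G0_scale G1_add G1_scale green G1_bdd in auto)
  have chi: "K 1 = boundary_triple.chi A G1"
    using K_out by (auto simp: boundary_triple.chi_def[OF triple] K_cnj fun_eq_iff)
  moreover have "R f = boundary_triple.real_part A G0 G1 f" if "f \<in> D" for f
    using that R_G0 R_out
    by (auto simp: boundary_triple.real_part_def[OF triple] boundary_triple.chi_def[OF triple]
        embed_def fun_eq_iff)
  ultimately show thesis
    using that[of G0] triple unfolding A_def B_def K_def R_def G1_def by blast
qed

section \<open>Adding a real constant to the impedance function\<close>

theorem theorem26:
  fixes \<kappa>\<^sub>0 Q :: real
    and V :: "complex \<Rightarrow> complex"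
    and \<Theta>\<^sub>0 :: "'h::chilbert_space l_system"
  assumes "0 \<le> \<kappa>\<^sub>0" and "\<kappa>\<^sub>0 < 1"
    and "V \<in> class_M \<kappa>\<^sub>0"
    and "realizes \<Theta>\<^sub>0 V"
    and "Q \<noteq> 0"
  shows "\<exists>\<Theta> :: 'h l_system. sym_op \<Theta> = sym_op \<Theta>\<^sub>0 \<and>
           realizes \<Theta> (\<lambda>z. complex_of_real Q + V z)"
proof -
  define A where "A = sym_op \<Theta>\<^sub>0"
  define G1 where "G1 = channel_adj (channel_op \<Theta>\<^sub>0)"
  have sys: "is_l_system \<Theta>\<^sub>0" and V: "\<And>z. Im z \<noteq> 0 \<Longrightarrow> V z = impedance \<Theta>\<^sub>0 z"
    using assms(4) by (auto simp: realizes_def)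
  obtain G0 where triple: "boundary_triple A G0 G1"
    and R: "\<And>f. f \<in> plus_space A \<Longrightarrow>
      rig_Re A (state_op \<Theta>\<^sub>0) f = boundary_triple.real_part A G0 G1 f"
    and chi: "channel_op \<Theta>\<^sub>0 1 = boundary_triple.chi A G1"
    using l_system_boundary_triple[OF sys] unfolding A_def G1_def by blast
  interpret old: boundary_triple A G0 G1 by (rule triple)
  interpret new: boundary_triple A G0 "\<lambda>f. G1 f + complex_of_real Q * G0 f"
    by (rule old.boundary_triple_shift)
  have "deficiency_indices A = (1, 1)"
    using sys by (simp add: is_l_system_def Let_def A_def)
  then have "is_l_system new.system" by (rule new.is_l_system_system)
  moreover have "complex_of_real Q + V z = impedance new.system z" if z: "Im z \<noteq> 0" for z
  proof -
    \<comment> \<open>The operator \<open>adj A\<close> and the map \<open>G0\<close> are shared by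
      the two triples, so one defect vector computes both impedance functions.\<close>
    obtain f where f: "(f, z *\<^sub>C f) \<in> adj A" "G0 f = 1"
      using old.defect_vector[OF z] by blast
    have "impedance \<Theta>\<^sub>0 z = G1 f"
      by (rule old.impedance_eq[OF A_def[symmetric] R chi z f])
    moreover have "impedance new.system z = G1 f + complex_of_real Q * G0 f"
    proof (rule new.impedance_eq[OF _ _ _ z f])
      show "sym_op new.system = A" "channel_op new.system 1 = new.chi"
        by (simp_all add: new.system_def)
    qed (rule new.system_Re_Im)
    ultimately show ?thesis using V[OF z] f(2) by simp
  qed
  moreover have "sym_op new.system = sym_op \<Theta>\<^sub>0" by (simp add: new.system_def A_def[symmetric])
  ultimately show ?thesis unfolding realizes_def by blast
qed

end
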